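(* Let $\vartheta$ be a primitive compatible random substitution on a two-letter alphabet $\{a,b\}$ whose second eigenvalue $\lambda_2$ is greater than $1$ in modulus, and suppose the tile lengths $\ell(a),\ell(b)$ are such that the ratio $\ell(a)/\ell(b)$ is irrational. Then the tiling space $\Omega_\vartheta$ is topologically mixing.
   Context: Random substitutions. $\mathcal{A}$ is a finite alphabet and $\mathcal{A}^+$ the set of non-empty finite words over it. A random substitution $\vartheta$ assigns to each $a\in\mathcal{A}$ a non-empty finite set $\vartheta(a)\subset\mathcal{A}^+$. It extends to words by $\vartheta(v_1\cdots v_m)=\{w_1\cdots w_m : w_i\in\vartheta(v_i)\}$ and to sets of words by $\vartheta(B)=\bigcup_{w\in B}\vartheta(w)$, so the powers $\vartheta^k$ are defined. A word is $\vartheta$-legal if it is a (contiguous) subword of some element of $\vartheta^k(a)$ for some $k\ge 1$, $a\in\mathcal{A}$. $\vartheta$ is compatible if, for each $a\in\mathcal{A}$, all words in $\vartheta(a)$ have the same number of occurrences of each letter; then the substitution matrix $M_\vartheta$ has columns indexed by letters, the column of $a$ giving the common letter counts of the words in $\vartheta(a)$. $\vartheta$ is primitive if some power of $M_\vartheta$ has all entries positive. On two letters, $\lambda_1$ is the Perron–Frobenius eigenvalue of $M_\vartheta$ and the second eigenvalue $\lambda_2$ is the other one. Tiling spaces. To each letter $a$ associate a labelled interval (tile) of length $\ell(a)>0$. To a (possibly infinite) word associate the patch obtained by laying the corresponding tiles end to end; a tiling is a bi-infinite patch covering $\mathbb{R}$. A finite patch is $\vartheta$-legal if its word is $\vartheta$-legal.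 $\Omega_\vartheta$ is the set of all tilings (with arbitrary position of the origin) all of whose finite patches are $\vartheta$-legal. $\mathbb{R}$ acts by translation, $T^t(\mathcal{T})=\mathcal{T}-t$, moving all tiles a distance $t$ to the left. The topology has as basis the cylinder sets $\mathcal{Z}_{P,U}=\{\mathcal{S}\in\Omega_\vartheta : P\subset\mathcal{S}-y\text{ for some }y\in U\}$, with $P$ a finite patch at a specified location and $U\subset\mathbb{R}$ open. $(\Omega_\vartheta,T)$ is topologically mixing if for any two non-empty open sets $\mathcal{Z}_1,\mathcal{Z}_2$ there is $R$ such that $T^t(\mathcal{Z}_1)\cap\mathcal{Z}_2\ne\varnothing$ for all $t>R$. *)

theory Defs
  imports
    "HOL-Library.Sublist"
    "HOL-Analysis.Abstract_Topology"
    "Jordan_Normal_Form.Spectral_Radius"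
begin

definition random_substitution :: "('a \<Rightarrow> 'a list set) \<Rightarrow> bool" where
  "random_substitution \<theta> \<longleftrightarrow> (\<forall>c. finite (\<theta> c) \<and> \<theta> c \<noteq> {} \<and> [] \<notin> \<theta> c)"

definition subst_word :: "('a \<Rightarrow> 'a list set) \<Rightarrow> 'a list \<Rightarrow> 'a list set" where
  "subst_word \<theta> v = {concat ws | ws. list_all2 (\<lambda>w c. w \<in> \<theta> c) ws v}"

definition subst_set :: "('a \<Rightarrow> 'a list set) \<Rightarrow> 'a list set \<Rightarrow> 'a list set" where
  "subst_set \<theta> B = (\<Union>w\<in>B. subst_word \<theta> w)"

definition legal :: "('a \<Rightarrow> 'a list set) \<Rightarrow> 'a list \<Rightarrow> bool" where
  "legal \<theta> u \<longleftrightarrow> (\<exists>k\<ge>1. \<exists>c. \<exists>w \<in> (subst_set \<theta> ^^ k) {[c]}. sublist u w)"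

definition compatible :: "('a \<Rightarrow> 'a list set) \<Rightarrow> bool" where
  "compatible \<theta> \<longleftrightarrow>
    (\<forall>c. \<forall>u\<in>\<theta> c. \<forall>v\<in>\<theta> c. \<forall>d. count_list u d = count_list v d)"

text \<open>The list \<open>cs\<close> enumerates the alphabet without repetition and fixes the order of rows and
  columns. For a compatible substitution the letter counts do not depend on the chosen word.\<close>

definition subst_matrix :: "'a list \<Rightarrow> ('a \<Rightarrow> 'a list set) \<Rightarrow> nat mat" where
  "subst_matrix cs \<theta> = mat (length cs) (length cs)
    (\<lambda>(i, j). count_list (SOME w. w \<in> \<theta> (cs ! j)) (cs ! i))"

definition primitive_mat :: "nat mat \<Rightarrow> bool" where
  "primitive_mat M \<longleftrightarrow>
    (\<exists>k\<ge>1. \<forall>i<dim_row M. \<forall>j<dim_col M. 0 < (M ^\<^sub>m k) $$ (i, j))"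

text \<open>The Perron--Frobenius eigenvalue of a primitive nonnegative matrix is its spectral radius; it
  is a simple eigenvalue, so for a \<open>2 \<times> 2\<close> matrix exactly one number satisfies the
  following predicate.\<close>

definition second_eigenvalue :: "nat mat \<Rightarrow> complex \<Rightarrow> bool" where
  "second_eigenvalue M \<mu> \<longleftrightarrow>
    eigenvalue (map_mat of_nat M) \<mu> \<and>
    \<mu> \<noteq> complex_of_real (spectral_radius (map_mat of_nat M))"

text \<open>A tile is a pair \<open>(x, c)\<close>, standing for the interval \<open>[x, x + len c]\<close> with label \<open>c\<close>;
  patches and tilings are sets of tiles.\<close>

type_synonym 'a tile = "real \<times> 'a"

definition tile_support :: "('a \<Rightarrow> real) \<Rightarrow> 'a tile \<Rightarrow> real set" where
  "tile_support len \<tau> = {fst \<tau> .. fst \<tau> + len (snd \<tau>)}"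

definition word_patch :: "('a \<Rightarrow> real) \<Rightarrow> real \<Rightarrow> 'a list \<Rightarrow> 'a tile set" where
  "word_patch len x w = {(x + (\<Sum>j<i. len (w ! j)), w ! i) | i. i < length w}"

definition biinfinite_patch :: "('a \<Rightarrow> real) \<Rightarrow> 'a tile set \<Rightarrow> bool" where
  "biinfinite_patch len T \<longleftrightarrow>
    (\<exists>(p :: int \<Rightarrow> real) (w :: int \<Rightarrow> 'a).
      (\<forall>i. p (i + 1) = p i + len (w i)) \<and> T = range (\<lambda>i. (p i, w i)))"

definition tiling :: "('a \<Rightarrow> real) \<Rightarrow> 'a tile set \<Rightarrow> bool" where
  "tiling len T \<longleftrightarrow> biinfinite_patch len T \<and> (\<Union>\<tau>\<in>T. tile_support len \<tau>) = UNIV"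

definition tiling_space :: "('a \<Rightarrow> 'a list set) \<Rightarrow> ('a \<Rightarrow> real) \<Rightarrow> 'a tile set set" where
  "tiling_space \<theta> len =
    {T. tiling len T \<and> (\<forall>x w. word_patch len x w \<subseteq> T \<longrightarrow> legal \<theta> w)}"

definition translate :: "real \<Rightarrow> 'a tile set \<Rightarrow> 'a tile set" where
  "translate t T = (\<lambda>(x, c). (x - t, c)) ` T"

definition cylinder ::
  "('a \<Rightarrow> 'a list set) \<Rightarrow> ('a \<Rightarrow> real) \<Rightarrow> 'a tile set \<Rightarrow> real set \<Rightarrow> 'a tile set set" where
  "cylinder \<theta> len P U = {S \<in> tiling_space \<theta> len. \<exists>y\<in>U. P \<subseteq> translate y S}"

text \<open>Every point of the intersection of two cylinder sets lies in a third one inside that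
  intersection, given by a patch containing both patches and a small interval. Hence the cylinder
  sets form a basis of the topology they generate.\<close>

definition tiling_topology :: "('a \<Rightarrow> 'a list set) \<Rightarrow> ('a \<Rightarrow> real) \<Rightarrow> 'a tile set topology" where
  "tiling_topology \<theta> len =
    topology_generated_by {cylinder \<theta> len (word_patch len x w) U | x w U. open U}"

definition topologically_mixing :: "'b topology \<Rightarrow> (real \<Rightarrow> 'b \<Rightarrow> 'b) \<Rightarrow> bool" where
  "topologically_mixing X \<phi> \<longleftrightarrow>
    (\<forall>V W. openin X V \<and> V \<noteq> {} \<and> openin X W \<and> W \<noteq> {} \<longrightarrow>
      (\<exists>R. \<forall>t>R. \<phi> t ` V \<inter> W \<noteq> {}))"

end

theory Submission
  imports Defs "HOL-Real_Asymp.Real_Asymp" "HOL-Analysis.Kronecker_Approximation_Theorem"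
begin

text \<open>
  Two cylinder sets meet after a translation by \<open>t\<close> if some legal word contains the two given
  words \<open>u\<close> and \<open>v\<close> at a distance close to \<open>t\<close>. So it has to be shown that the achievable
  distances become dense near infinity.

  The source of freedom is the discrepancy. Compatibility makes the substitution act on letter
  counts by its matrix, so a left eigenvector for \<open>\<lambda>\<^sub>2\<close> gives an additive functional \<open>f\<close> on words
  that every realisation of the substitution multiplies by \<open>\<lambda>\<^sub>2\<close>. Since \<open>f\<close> has mean zero, all
  words of length \<open>n\<close> having nearly the same letter counts would mean that \<open>f\<close> is bounded on words
  of this size. As \<open>\<bar>\<lambda>\<^sub>2\<bar> > 1\<close>, a bound at one size is inherited by all sizes smaller by a power of
  \<open>\<lambda>\<^sub>1\<close>, and cutting a word into pieces of these sizes shows that \<open>f\<close> grows at most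
  logarithmically, against its exponential growth along the iterates. Therefore the spread of the
  letter counts among legal words of length \<open>n\<close> tends to infinity with \<open>n\<close>
  (\<open>discrepancy_unbounded\<close>).

  Sliding a window of length \<open>n\<close> along a legal word changes the number of \<open>a\<close> by at most one, and
  it increases exactly if a \<open>b\<close> leaves and an \<open>a\<close> enters. So all intermediate letter counts are
  attained by words that start with \<open>b\<close> and are followed by \<open>a\<close>
  (\<open>legal_window_of_each_count\<close>). Their letter counts fill the lattice points of a strip whose
  width tends to infinity, and for an irrational ratio of tile lengths the lengths belonging to
  these points become dense (\<open>lattice_strip_dense\<close>). Finally \<open>b\<close> and \<open>a\<close> are
  inflated to words containing \<open>u\<close> and \<open>v\<close>. The inflated lengths are again rationally
  independent, since the substitution matrix is invertible.
\<close>

section \<open>Weights of words\<close>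

definition weight :: "('a \<Rightarrow> real) \<Rightarrow> 'a list \<Rightarrow> real" where
  "weight h w = sum_list (map h w)"

lemma weight_simps [simp]:
  "weight h [] = 0"
  "weight h (c # w) = h c + weight h w"
  "weight h (u @ v) = weight h u + weight h v"
  by (simp_all add: weight_def)

lemma weight_uminus: "weight (\<lambda>c. - h c) w = - weight h w"
  by (induction w) auto

lemma weight_scale: "weight (\<lambda>c. l * h c) w = l * weight h w"
  by (induction w) (auto simp: algebra_simps)

lemma weight_bounds:
  assumes "\<And>c. m \<le> h c" "\<And>c. h c \<le> M"
  shows "real (length w) * m \<le> weight h w" "weight h w \<le> real (length w) * M"
proof (induction w)
  case (Cons c w)
  { case 1 then show ?case using Cons(1) assms(1)[of c] by (simp add: algebra_simps) }
  { case 2 then show ?case using Cons(2) assms(2)[of c] by (simp add: algebra_simps) }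
qed auto

lemma abs_weight_le:
  assumes "\<And>c. \<bar>h c\<bar> \<le> M"
  shows "\<bar>weight h w\<bar> \<le> real (length w) * M"
proof (induction w)
  case (Cons c w)
  then show ?case using assms[of c] by (simp add: algebra_simps)
qed auto

text \<open>The reason why weights are well defined on the images under a compatible substitution.\<close>

lemma weight_cong_count:
  assumes "\<And>d. count_list u d = count_list v d"
  shows "weight h u = weight h v"
proof -
  have "mset u = mset v"
    by (rule multiset_eqI) (simp add: count_mset assms)
  then have "sum_mset (image_mset h (mset u)) = sum_mset (image_mset h (mset v))" by simp
  then show ?thesis by (simp add: weight_def sum_mset_sum_list flip: mset_map)
qed

lemma weight_two_letters:
  fixes w :: "'a list"
  assumes "a \<noteq> b" "(UNIV :: 'a set) = {a, b}"
  shows "weight h w = real (count_list w a) * h a + real (count_list w b) * h b"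
proof (induction w)
  case (Cons c w)
  have "c = a \<or> c = b" using assms(2) by auto
  then show ?case using Cons assms(1) by (auto simp: algebra_simps)
qed simp

section \<open>Powers of a random substitution\<close>

definition power_words :: "('a \<Rightarrow> 'a list set) \<Rightarrow> nat \<Rightarrow> 'a list \<Rightarrow> 'a list set" where
  "power_words \<theta> k w = (subst_set \<theta> ^^ k) {w}"

lemma subst_word_Nil [simp]: "subst_word \<theta> [] = {[]}"
  by (auto simp: subst_word_def)

lemma subst_word_Cons:
  "subst_word \<theta> (c # v) = {x @ y | x y. x \<in> \<theta> c \<and> y \<in> subst_word \<theta> v}"
proof (intro equalityI subsetI)
  fix w assume "w \<in> subst_word \<theta> (c # v)"
  then obtain ws where "w = concat ws" "list_all2 (\<lambda>w c. w \<in> \<theta> c) ws (c # v)"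
    by (auto simp: subst_word_def)
  then show "w \<in> {x @ y | x y. x \<in> \<theta> c \<and> y \<in> subst_word \<theta> v}"
    by (fastforce simp: list_all2_Cons2 subst_word_def)
next
  fix w assume "w \<in> {x @ y | x y. x \<in> \<theta> c \<and> y \<in> subst_word \<theta> v}"
  then obtain x ws where "w = x @ concat ws" "x \<in> \<theta> c" "list_all2 (\<lambda>w c. w \<in> \<theta> c) ws v"
    by (auto simp: subst_word_def)
  then show "w \<in> subst_word \<theta> (c # v)"
    unfolding subst_word_def by (auto intro!: exI[of _ "x # ws"])
qed

lemma subst_word_append:
  "subst_word \<theta> (u @ v) = {x @ y | x y. x \<in> subst_word \<theta> u \<and> y \<in> subst_word \<theta> v}"
proof (induction u)
  case (Cons c u)
  then show ?case by (auto simp: subst_word_Cons) (metis append.assoc)+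
qed simp

lemma power_words_0 [simp]: "power_words \<theta> 0 w = {w}"
  by (simp add: power_words_def)

lemma power_words_Suc:
  "power_words \<theta> (Suc k) w = (\<Union>v\<in>power_words \<theta> k w. subst_word \<theta> v)"
  by (simp add: power_words_def subst_set_def)

lemma power_words_add:
  "power_words \<theta> (m + n) w = (\<Union>v\<in>power_words \<theta> n w. power_words \<theta> m v)"
  by (induction m) (auto simp: power_words_Suc)

lemma power_words_append:
  "power_words \<theta> k (u @ v) = {x @ y | x y. x \<in> power_words \<theta> k u \<and> y \<in> power_words \<theta> k v}"
proof (induction k)
  case (Suc k)
  then show ?case by (force simp: power_words_Suc subst_word_append)
qed auto

lemma power_words_appendI:
  "x \<in> power_words \<theta> k u \<Longrightarrow> y \<in> power_words \<theta> k v \<Longrightarrow> x @ y \<in> power_words \<theta> k (u @ v)"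
  by (auto simp: power_words_append)

lemma legal_iff: "legal \<theta> u \<longleftrightarrow> (\<exists>k\<ge>1. \<exists>c. \<exists>w\<in>power_words \<theta> k [c]. sublist u w)"
  by (simp add: legal_def power_words_def)

lemma legal_sublist: "legal \<theta> v \<Longrightarrow> sublist u v \<Longrightarrow> legal \<theta> u"
  unfolding legal_def by (meson sublist_order.dual_order.trans)

text \<open>On the level of weights a compatible random substitution is deterministic. This is the
  action of the transposed substitution matrix on weights.\<close>

definition pull_weight :: "('a \<Rightarrow> 'a list set) \<Rightarrow> ('a \<Rightarrow> real) \<Rightarrow> 'a \<Rightarrow> real" where
  "pull_weight \<theta> h c = weight h (SOME w. w \<in> \<theta> c)"

locale compatible_substitution =
  fixes \<theta> :: "'a \<Rightarrow> 'a list set"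
  assumes random: "random_substitution \<theta>" and compatible: "compatible \<theta>"
begin

lemma weight_image: "w \<in> \<theta> c \<Longrightarrow> weight h w = pull_weight \<theta> h c"
  unfolding pull_weight_def
  using compatible by (intro weight_cong_count) (metis compatible_def someI)

lemma weight_subst_word: "v \<in> subst_word \<theta> w \<Longrightarrow> weight h v = weight (pull_weight \<theta> h) w"
proof (induction w arbitrary: v)
  case (Cons c w)
  then show ?case by (auto simp: subst_word_Cons weight_image)
qed simp

lemma weight_power_words:
  "v \<in> power_words \<theta> k w \<Longrightarrow> weight h v = weight ((pull_weight \<theta> ^^ k) h) w"
  by (induction k arbitrary: v h)
    (auto simp: power_words_Suc weight_subst_word simp del: funpow.simps simp: funpow_Suc_right)

lemma subst_word_nonempty: "\<exists>v. v \<in> subst_word \<theta> w"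
proof (induction w)
  case (Cons c w)
  have "\<exists>x. x \<in> \<theta> c" using random by (auto simp: random_substitution_def)
  with Cons show ?case by (auto simp: subst_word_Cons)
qed simp

lemma power_words_nonempty: "\<exists>v. v \<in> power_words \<theta> k w"
  using subst_word_nonempty by (induction k) (simp_all add: power_words_Suc, blast)

lemma subst_word_not_Nil: "v \<in> subst_word \<theta> w \<Longrightarrow> w \<noteq> [] \<Longrightarrow> v \<noteq> []"
  using random by (cases w) (auto simp: subst_word_Cons random_substitution_def)

lemma power_words_not_Nil: "v \<in> power_words \<theta> k w \<Longrightarrow> w \<noteq> [] \<Longrightarrow> v \<noteq> []"
proof (induction k arbitrary: v)
  case (Suc k)
  then show ?case using subst_word_not_Nil by (metis UN_E power_words_Suc)
qed simp

lemma legal_power_words: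
  assumes "legal \<theta> u" "v \<in> power_words \<theta> m u"
  shows "legal \<theta> v"
proof -
  obtain k c w x y where k: "k \<ge> 1" "w \<in> power_words \<theta> k [c]" and w: "w = x @ u @ y"
    using assms(1) by (auto simp: legal_iff sublist_def)
  obtain x' y' where "x' \<in> power_words \<theta> m x" "y' \<in> power_words \<theta> m y"
    using power_words_nonempty by meson
  with assms(2) have "x' @ v @ y' \<in> power_words \<theta> m w"
    unfolding w by (intro power_words_appendI)
  with k have "x' @ v @ y' \<in> power_words \<theta> (m + k) [c]" "m + k \<ge> 1"
    by (auto simp: power_words_add)
  then show ?thesis unfolding legal_iff by blast
qed

end

section \<open>The language of a primitive substitution\<close>

text \<open>The parameter \<open>p\<close> is an exponent for which the power of the substitution matrix is positive.
  Stated for words, this is all that the combinatorics of the language needs.\<close>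

locale primitive_substitution = compatible_substitution \<theta>
  for \<theta> :: "'a \<Rightarrow> 'a list set" +
  fixes a b :: 'a and p :: nat
  assumes ab: "a \<noteq> b" and UNIV_ab: "(UNIV :: 'a set) = {a, b}"
    and primitive: "w \<in> power_words \<theta> p [c] \<Longrightarrow> d \<in> set w"
begin

lemma letter_cases: "c = a \<or> c = b"
  using UNIV_ab by auto

lemma weight_via_count:
  "weight h w = real (count_list w a) * h a + (real (length w) - real (count_list w a)) * h b"
proof -
  have "weight (\<lambda>_. 1) w = real (length w)" by (induction w) auto
  then have "real (count_list w b) = real (length w) - real (count_list w a)"
    using weight_two_letters[OF ab UNIV_ab, of "\<lambda>_. 1" w] by simp
  then show ?thesis using weight_two_letters[OF ab UNIV_ab, of h w] by simp
qed

lemma all_letters_occur: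
  assumes "p \<le> k" "w \<in> power_words \<theta> k [c]"
  shows "d \<in> set w"
proof -
  obtain v where v: "v \<in> power_words \<theta> (k - p) [c]" "w \<in> power_words \<theta> p v"
    using assms power_words_add[of \<theta> p "k - p"] by auto
  then obtain e v' where "v = [e] @ v'"
    using power_words_not_Nil by (metis append_Cons append_Nil list.exhaust not_Cons_self2)
  with v(2) show ?thesis
    using primitive by (auto simp only: power_words_append set_append)
qed

text \<open>The number of iterations needed is uniform in the starting letter and in all larger
  exponents, so that finitely many legal words can be realised in the same power.\<close>

lemma legal_occurs_eventually:
  assumes "legal \<theta> u"
  shows "\<exists>k0. \<forall>k\<ge>k0. \<forall>c. \<exists>w\<in>power_words \<theta> k [c]. sublist u w"
proof -
  obtain m d w0 where w0: "w0 \<in> power_words \<theta> m [d]" "sublist u w0"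
    using assms by (auto simp: legal_iff)
  have "\<exists>w\<in>power_words \<theta> k [c]. sublist u w" if "k \<ge> m + p" for k c
  proof -
    obtain v where v: "v \<in> power_words \<theta> (k - m) [c]"
      using power_words_nonempty by blast
    then have "d \<in> set v" using all_letters_occur[of "k - m" v] that by auto
    then obtain x y where vxy: "v = x @ [d] @ y" by (auto simp: in_set_conv_decomp)
    obtain x' y' where "x' \<in> power_words \<theta> m x" "y' \<in> power_words \<theta> m y"
      using power_words_nonempty by meson
    with w0 have "x' @ w0 @ y' \<in> power_words \<theta> m v"
      unfolding vxy by (intro power_words_appendI)
    with v have "x' @ w0 @ y' \<in> power_words \<theta> (m + (k - m)) [c]"
      by (subst power_words_add) auto
    moreover have "sublist u (x' @ w0 @ y')" using w0(2) by (auto simp: sublist_appendI sublist_append)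
    ultimately show ?thesis using that by auto
  qed
  then show ?thesis by blast
qed

lemma legal_two_letters: "\<exists>c d. legal \<theta> [c, d]"
proof -
  obtain w where w: "w \<in> power_words \<theta> (Suc p) [a]" using power_words_nonempty by blast
  then have "a \<in> set w" "b \<in> set w" using all_letters_occur[of "Suc p"] by auto
  with ab obtain c d v where "w = c # d # v"
    by (cases w; cases "tl w") auto
  then have "sublist [c, d] w" by (simp add: sublist_Cons_right)
  with w show ?thesis unfolding legal_iff by (metis le_add1 plus_1_eq_Suc)
qed

text \<open>Realise both words in a common power and apply that power to a legal word of two letters.\<close>

lemma legal_irreducible:
  assumes "legal \<theta> u" "legal \<theta> v"
  shows "\<exists>z. legal \<theta> (u @ z @ v)"
proof -
  obtain k where k: "\<And>c. \<exists>w\<in>power_words \<theta> k [c]. sublist u w"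
    "\<And>c. \<exists>w\<in>power_words \<theta> k [c]. sublist v w"
    using assms[THEN legal_occurs_eventually] by (metis max.cobounded1 max.cobounded2)
  obtain c d where cd: "legal \<theta> ([c] @ [d])" using legal_two_letters by auto
  obtain x1 x2 y1 y2 where "x1 @ u @ x2 \<in> power_words \<theta> k [c]" "y1 @ v @ y2 \<in> power_words \<theta> k [d]"
    using k unfolding sublist_def by metis
  then have "(x1 @ u @ x2) @ (y1 @ v @ y2) \<in> power_words \<theta> k ([c] @ [d])"
    by (intro power_words_appendI)
  with cd have "legal \<theta> ((x1 @ u @ x2) @ (y1 @ v @ y2))" by (rule legal_power_words)
  then have "legal \<theta> (u @ (x2 @ y1) @ v)"
    by (rule legal_sublist) (auto simp: sublist_def)
  then show ?thesis by blast
qed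

lemma legal_letter: "legal \<theta> [c]"
proof -
  obtain w where w: "w \<in> power_words \<theta> (Suc p) [a]" using power_words_nonempty by blast
  then have "c \<in> set w" using all_letters_occur[of "Suc p"] by auto
  then have "sublist [c] w" by (auto simp: in_set_conv_decomp sublist_def)
  with w show ?thesis unfolding legal_iff by (metis le_add1 plus_1_eq_Suc)
qed

lemma legal_extend_right: "legal \<theta> u \<Longrightarrow> \<exists>d. legal \<theta> (u @ [d])"
proof -
  assume "legal \<theta> u"
  then obtain z where z: "legal \<theta> (u @ z @ [a])" using legal_irreducible legal_letter by blast
  obtain d y where "z @ [a] = [d] @ y" by (cases z) auto
  then have "sublist (u @ [d]) (u @ z @ [a])" by (auto simp: sublist_def)
  with z show ?thesis using legal_sublist by blast
qed

lemma legal_extend_left: "legal \<theta> u \<Longrightarrow> \<exists>d. legal \<theta> (d # u)"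
proof -
  assume "legal \<theta> u"
  then obtain z where z: "legal \<theta> ([a] @ z @ u)" using legal_irreducible legal_letter by blast
  obtain d y where "[a] @ z = y @ [d]" by (cases z rule: rev_cases) auto
  then have "[a] @ z @ u = y @ (d # u)" by (metis append.assoc append_Cons append_Nil)
  then have "sublist (d # u) ([a] @ z @ u)" by (metis append_Nil2 sublist_appendI append.assoc)
  with z show ?thesis using legal_sublist by blast
qed

lemma legal_Nil: "legal \<theta> []"
  using legal_letter legal_sublist by (metis sublist_Nil_left)

lemma ex_legal_length: "\<exists>w. legal \<theta> w \<and> length w = n"
proof (induction n)
  case (Suc n)
  then show ?case using legal_extend_right by (metis length_append_singleton)
qed (use legal_Nil in auto)

lemma legal_extend_by: "legal \<theta> w \<Longrightarrow> \<exists>v. length v = n \<and> legal \<theta> (w @ v)"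
proof (induction n)
  case (Suc n)
  then show ?case using legal_extend_right by (metis append.assoc length_append_singleton)
qed auto

text \<open>The growth to infinity is required along all lengths, not only along a subsequence: the
  mixing time must work for every large translation.\<close>

definition unbounded_discrepancy :: bool where
  "unbounded_discrepancy \<longleftrightarrow> (\<forall>D. \<exists>N. \<forall>n\<ge>N. \<exists>u v. legal \<theta> u \<and> legal \<theta> v \<and>
     length u = n \<and> length v = n \<and> count_list v a + D \<le> count_list u a)"

end

section \<open>Discrepancy of letter frequencies\<close>

text \<open>The weights \<open>g\<close> and \<open>f\<close> are left eigenvectors of the substitution matrix. The positive one,
  \<open>g\<close>, measures the size of a word so that the substitution scales sizes exactly by \<open>l1\<close>.\<close>

locale expanding_substitution = primitive_substitution \<theta> a b p
  for \<theta> :: "'a \<Rightarrow> 'a list set" and a b :: 'a and p :: nat +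
  fixes g f :: "'a \<Rightarrow> real" and l1 l2 :: real
  assumes eigen_g: "pull_weight \<theta> g c = l1 * g c"
    and eigen_f: "pull_weight \<theta> f c = l2 * f c"
    and g_pos: "0 < g c" and f_a: "f a \<noteq> 0"
    and l2: "1 < \<bar>l2\<bar>" and l1: "\<bar>l2\<bar> < l1"
begin

lemma weight_eigen:
  assumes "\<And>c. pull_weight \<theta> h c = l * h c" "v \<in> power_words \<theta> k w"
  shows "weight h v = l ^ k * weight h w"
  using assms(2)
proof (induction k arbitrary: v)
  case (Suc k)
  then obtain u where "u \<in> power_words \<theta> k w" "v \<in> subst_word \<theta> u"
    by (auto simp: power_words_Suc)
  moreover have "pull_weight \<theta> h = (\<lambda>c. l * h c)" using assms(1) by auto
  ultimately show ?case using Suc.IH by (simp add: weight_subst_word weight_scale)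
qed simp

definition g_max :: real where "g_max = max (g a) (g b)"
definition g_min :: real where "g_min = min (g a) (g b)"
definition slope :: real where "slope = max (\<bar>f a\<bar> / g a) (\<bar>f b\<bar> / g b)"

lemma g_le: "g c \<le> g_max" and g_ge: "g_min \<le> g c"
  using letter_cases[of c] by (auto simp: g_max_def g_min_def)

lemma g_min_pos: "0 < g_min" and g_max_pos: "0 < g_max" and slope_nonneg: "0 \<le> slope"
  using g_pos[of a] g_pos[of b] by (auto simp: g_min_def g_max_def slope_def le_max_iff_disj less_max_iff_disj)

lemma abs_f_le: "\<bar>f c\<bar> \<le> slope * g c"
proof -
  have "\<bar>f c\<bar> / g c \<le> slope" using letter_cases[of c] by (auto simp: slope_def)
  then show ?thesis using g_pos[of c] by (simp add: divide_le_eq)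
qed

lemma abs_weight_f_le: "\<bar>weight f w\<bar> \<le> slope * weight g w"
proof (induction w)
  case (Cons c w)
  then show ?case using abs_f_le[of c] by (simp add: distrib_left)
qed simp

text \<open>An eigenweight for \<open>l2\<close> has mean zero: if it exceeded 1 on every word of length \<open>n\<close>, it would
  grow linearly in the length, whereas on the iterates it grows like \<open>\<bar>l2\<bar> ^ k\<close> and the length grows
  like \<open>l1 ^ k\<close>. The lemma is stated for a general \<open>h\<close> because it is applied to \<open>f\<close> and to \<open>- f\<close>.\<close>

lemma ex_legal_weight_le_1:
  assumes h: "\<And>c. pull_weight \<theta> h c = l2 * h c" and "n \<ge> 1"
  shows "\<exists>w. legal \<theta> w \<and> length w = n \<and> weight h w \<le> 1"
proof (rule ccontr)
  assume "\<not> ?thesis"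
  then have big: "weight h w > 1" if "legal \<theta> w" "length w = n" for w
    using that by force
  define H where "H = max \<bar>h a\<bar> \<bar>h b\<bar>"
  have H: "\<bar>h c\<bar> \<le> H" for c using letter_cases[of c] by (auto simp: H_def)
  have "0 \<le> H" by (auto simp: H_def)
  \<comment> \<open>Each complete block of length \<open>n\<close> contributes more than 1; the subtracted terms pay for the
    incomplete last block.\<close>
  have lower: "weight h w \<ge> real (length w) / n - 1 - n * H" if "legal \<theta> w" for w
    using that
  proof (induction "length w" arbitrary: w rule: less_induct)
    case less
    show ?case
    proof (cases "length w < n")
      case True
      have "\<bar>weight h w\<bar> \<le> length w * H" by (intro abs_weight_le H)
      also have "\<dots> \<le> n * H" using True \<open>0 \<le> H\<close> by (intro mult_right_mono) auto
      finally have "weight h w \<ge> - (n * H)" by linarith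
      moreover have "real (length w) / n \<le> 1" using True \<open>n \<ge> 1\<close> by simp
      ultimately show ?thesis by linarith
    next
      case False
      have leg: "legal \<theta> (take n w)" "legal \<theta> (drop n w)"
        using legal_sublist[OF less.prems] by auto
      have "weight h w = weight h (take n w) + weight h (drop n w)"
        by (metis append_take_drop_id weight_simps(3))
      moreover have "weight h (take n w) > 1" using big[OF leg(1)] False by simp
      moreover have "weight h (drop n w) \<ge> real (length (drop n w)) / n - 1 - n * H"
        using leg(2) False \<open>n \<ge> 1\<close> by (intro less.hyps) auto
      moreover have "real (length (drop n w)) / n = real (length w) / n - 1"
        using False \<open>n \<ge> 1\<close> by (simp add: of_nat_diff diff_divide_distrib)
      ultimately show ?thesis by linarith
    qed
  qed
  define D where "D = \<bar>h a\<bar> + 1 + n * H"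
  define q where "q = l1 / \<bar>l2\<bar>"
  have q: "q > 1" using l1 l2 by (simp add: q_def)
  have "q ^ k * (g a / (g_max * n)) \<le> D" for k
  proof -
    obtain w where w: "w \<in> power_words \<theta> k [a]" using power_words_nonempty by blast
    then have "legal \<theta> w" using legal_power_words legal_letter by blast
    then have 1: "weight h w \<ge> real (length w) / n - 1 - n * H" by (rule lower)
    have "weight g w \<le> real (length w) * g_max"
      by (rule weight_bounds(2)[of 0]) (use g_pos g_le in \<open>auto simp: less_imp_le\<close>)
    then have "l1 ^ k * g a \<le> real (length w) * g_max"
      using weight_eigen[OF eigen_g w] by simp
    then have "l1 ^ k * g a / g_max \<le> real (length w)" using g_max_pos by (simp add: divide_le_eq)
    then have 2: "l1 ^ k * g a / g_max / n \<le> real (length w) / n"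
      by (intro divide_right_mono) auto
    have "weight h w = l2 ^ k * h a" using weight_eigen[OF h w] by simp
    also have "\<dots> \<le> \<bar>l2\<bar> ^ k * \<bar>h a\<bar>" by (metis abs_ge_self abs_mult power_abs)
    finally have "l1 ^ k * g a / g_max / n \<le> \<bar>l2\<bar> ^ k * \<bar>h a\<bar> + (1 + n * H) * 1" using 1 2 by simp
    also have "\<dots> \<le> \<bar>l2\<bar> ^ k * \<bar>h a\<bar> + (1 + n * H) * \<bar>l2\<bar> ^ k"
      using l2 \<open>0 \<le> H\<close> by (intro add_left_mono mult_left_mono) (auto simp: one_le_power)
    also have "\<dots> = \<bar>l2\<bar> ^ k * D" by (simp add: D_def algebra_simps)
    finally have "l1 ^ k * g a / g_max / n \<le> \<bar>l2\<bar> ^ k * D" .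
    moreover have "0 < \<bar>l2\<bar> ^ k" using l2 by (intro zero_less_power) linarith
    ultimately have "l1 ^ k * g a / g_max / n / \<bar>l2\<bar> ^ k \<le> D"
      by (simp only: divide_le_eq mult.commute if_True)
    then show ?thesis by (simp add: q_def power_divide mult_ac)
  qed
  moreover obtain k where "D / (g a / (g_max * n)) < q ^ k" using real_arch_pow[OF q] by blast
  moreover have "0 < g a / (g_max * n)" using g_pos g_max_pos \<open>n \<ge> 1\<close> by simp
  ultimately show False by (metis divide_less_eq leD)
qed

lemma prefix_of_weight:
  assumes "0 \<le> s" "s \<le> weight g w"
  shows "\<exists>u v. w = u @ v \<and> s \<le> weight g u \<and> weight g u \<le> s + g_max"
  using assms
proof (induction w arbitrary: s)
  case Nil
  then show ?case using g_max_pos by auto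
next
  case (Cons c w)
  show ?case
  proof (cases "s \<le> g c")
    case True
    then show ?thesis using g_le[of c] Cons.prems by (intro exI[of _ "[c]"] exI[of _ w]) auto
  next
    case False
    then obtain u v where "w = u @ v" "s - g c \<le> weight g u" "weight g u \<le> s - g c + g_max"
      using Cons.IH[of "s - g c"] Cons.prems by auto
    then show ?thesis by (intro exI[of _ "c # u"] exI[of _ v]) auto
  qed
qed

text \<open>Cutting or prolonging a word on the right brings its size near any target, at a cost in \<open>f\<close>
  that is controlled by the change of size.\<close>

lemma adjust_weight:
  assumes "legal \<theta> w" "0 \<le> s"
  shows "\<exists>w'. legal \<theta> w' \<and> \<bar>weight g w' - s\<bar> \<le> g_max \<and>
    \<bar>weight f w' - weight f w\<bar> \<le> slope * (\<bar>weight g w - s\<bar> + g_max)"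
proof (cases "s \<le> weight g w")
  case True
  then obtain u v where uv: "w = u @ v" "s \<le> weight g u" "weight g u \<le> s + g_max"
    using prefix_of_weight assms by blast
  have "\<bar>weight f v\<bar> \<le> slope * weight g v" by (rule abs_weight_f_le)
  also have "\<dots> \<le> slope * (\<bar>weight g w - s\<bar> + g_max)"
    using uv g_max_pos by (intro mult_left_mono slope_nonneg) auto
  finally show ?thesis
    using uv legal_sublist[OF assms(1)] by (intro exI[of _ u]) auto
next
  case False
  obtain n where n: "(s - weight g w) / g_min < real n" using reals_Archimedean2 by blast
  obtain v where v: "length v = n" "legal \<theta> (w @ v)" using legal_extend_by assms by blast
  have "real (length v) * g_min \<le> weight g v"
    by (rule weight_bounds(1)) (auto intro: g_ge g_le)
  then have "s - weight g w \<le> weight g v" using n v g_min_pos by (simp add: divide_less_eq)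
  then obtain v1 v2 where v12: "v = v1 @ v2" "s - weight g w \<le> weight g v1"
    "weight g v1 \<le> s - weight g w + g_max"
    using prefix_of_weight[of "s - weight g w" v] False by auto
  have "\<bar>weight f v1\<bar> \<le> slope * weight g v1" by (rule abs_weight_f_le)
  also have "\<dots> \<le> slope * (\<bar>weight g w - s\<bar> + g_max)"
    using v12 False by (intro mult_left_mono slope_nonneg) auto
  finally show ?thesis
    using v12 v(2) legal_sublist[of \<theta> "w @ v" "w @ v1"] by (intro exI[of _ "w @ v1"]) (auto simp: sublist_def)
qed

text \<open>The tolerance is the largest size of a letter, so that every word of size at
  least \<open>s\<close> has a prefix whose size is \<open>s\<close> up to this tolerance.\<close>

definition bounded_at :: "real \<Rightarrow> real \<Rightarrow> bool" where
  "bounded_at s B \<longleftrightarrow> (\<forall>w. legal \<theta> w \<and> \<bar>weight g w - s\<bar> \<le> g_max \<longrightarrow> \<bar>weight f w\<bar> \<le> B)"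

text \<open>A bound \<open>B\<close> satisfies \<open>B + slope * (l1 * g_max + g_max) \<le> \<bar>l2\<bar> * B\<close> if and only if it is at least
  this threshold. Such bounds survive the passage to the next smaller scale.\<close>

definition threshold :: real where "threshold = slope * (l1 * g_max + g_max) / (\<bar>l2\<bar> - 1)"

text \<open>The image of a word of size near \<open>s / l1\<close> has size within \<open>l1 * g_max\<close> of \<open>s\<close>. After an
  adjustment the bound at \<open>s\<close> applies to it, and dividing by \<open>\<bar>l2\<bar>\<close> absorbs the cost.\<close>

lemma bounded_at_scale_down:
  assumes "bounded_at s B" "0 \<le> s" "threshold \<le> B"
  shows "bounded_at (s / l1) B"
  unfolding bounded_at_def
proof (intro allI impI)
  fix w assume w: "legal \<theta> w \<and> \<bar>weight g w - s / l1\<bar> \<le> g_max"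
  have l1_pos: "0 < l1" using l1 by linarith
  obtain v where v: "v \<in> power_words \<theta> 1 w" using power_words_nonempty by blast
  then have legv: "legal \<theta> v" using w legal_power_words by blast
  have gv: "weight g v = l1 * weight g w" and fv: "weight f v = l2 * weight f w"
    using weight_eigen[OF eigen_g v] weight_eigen[OF eigen_f v] by auto
  have "weight g v - s = l1 * (weight g w - s / l1)" using l1_pos by (simp add: gv field_simps)
  then have gvs: "\<bar>weight g v - s\<bar> \<le> l1 * g_max" using w l1_pos by (simp add: abs_mult)
  obtain v' where v': "legal \<theta> v'" "\<bar>weight g v' - s\<bar> \<le> g_max"
    "\<bar>weight f v' - weight f v\<bar> \<le> slope * (\<bar>weight g v - s\<bar> + g_max)"
    using adjust_weight[OF legv assms(2)] by blast
  have "slope * (\<bar>weight g v - s\<bar> + g_max) \<le> slope * (l1 * g_max + g_max)"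
    using gvs by (intro mult_left_mono slope_nonneg) auto
  also have "\<dots> = threshold * (\<bar>l2\<bar> - 1)" using l2 by (simp add: threshold_def)
  also have "\<dots> \<le> B * (\<bar>l2\<bar> - 1)" using assms(3) l2 by (intro mult_right_mono) auto
  finally have "\<bar>weight f v\<bar> \<le> B + B * (\<bar>l2\<bar> - 1)"
    using v' assms(1) unfolding bounded_at_def by fastforce
  then have "\<bar>l2\<bar> * \<bar>weight f w\<bar> \<le> \<bar>l2\<bar> * B" by (simp add: fv abs_mult algebra_simps)
  moreover have "0 < \<bar>l2\<bar>" using l2 by linarith
  ultimately show "\<bar>weight f w\<bar> \<le> B" by (simp only: mult_le_cancel_left_pos)
qed

text \<open>Cut off prefixes of size approximately \<open>s\<close>; each of them costs at most \<open>B\<close>.\<close>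

lemma bounded_below_multiple:
  assumes "bounded_at s B" "0 < s" "0 \<le> B"
    and small: "\<And>w. legal \<theta> w \<Longrightarrow> weight g w < s \<Longrightarrow> \<bar>weight f w\<bar> \<le> E"
  shows "legal \<theta> w \<Longrightarrow> weight g w < real (Suc k) * s \<Longrightarrow> \<bar>weight f w\<bar> \<le> E + real k * B"
proof (induction k arbitrary: w)
  case 0
  then show ?case using small by simp
next
  case (Suc k)
  show ?case
  proof (cases "weight g w < s")
    case True
    then have "\<bar>weight f w\<bar> \<le> E" using small Suc.prems by blast
    moreover have "0 \<le> real (Suc k) * B" using assms(3) by simp
    ultimately show ?thesis by linarith
  next
    case False
    then obtain u v where uv: "w = u @ v" "s \<le> weight g u" "weight g u \<le> s + g_max"
      using prefix_of_weight[of s w] assms by auto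
    then have leg: "legal \<theta> u" "legal \<theta> v" using legal_sublist[OF Suc.prems(1)] by auto
    have "\<bar>weight f u\<bar> \<le> B" using assms(1) leg uv unfolding bounded_at_def by auto
    moreover have "\<bar>weight f v\<bar> \<le> E + real k * B"
      using Suc.prems(2) uv by (intro Suc.IH leg) (auto simp: algebra_simps)
    ultimately show ?thesis by (simp add: uv algebra_simps)
  qed
qed

text \<open>A bound at the scale \<open>s\<close> passes to the scales \<open>s / l1\<close>, \<open>s / l1\<^sup>2\<close> and so on, down to a scale
  between 1 and \<open>l1\<close>. Going up again, each scale costs at most \<open>K * B\<close> for an integer
  \<open>K \<ge> l1\<close>, so that \<open>f\<close> grows at most linearly in the exponent of the scale. This contradicts
  its exponential growth along the iterates of a letter.\<close>

lemma not_bounded_at_large: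
  assumes "threshold \<le> B" "0 \<le> B"
  shows "\<exists>s0. \<forall>s\<ge>s0. \<not> bounded_at s B"
proof -
  have l1_gt: "1 < l1" using l1 l2 by linarith
  obtain K :: nat where K: "l1 \<le> real K" using real_arch_simple by blast
  obtain j where j: "g a < l1 ^ j" using real_arch_pow[OF l1_gt] by blast
  have f_a': "0 < \<bar>f a\<bar>" using f_a by simp
  \<comment> \<open>The right-hand side is the value of \<open>\<bar>f\<bar>\<close> on an image of \<open>a\<close> under the power \<open>J - j\<close>, whose
    size is below \<open>l1 ^ J\<close> by the choice of \<open>j\<close>.\<close>
  have "\<forall>\<^sub>F J in at_top. slope * l1 + real J * (real K * B) < \<bar>l2\<bar> ^ J * (\<bar>f a\<bar> / \<bar>l2\<bar> ^ j)"
  proof -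
    define q where "q = \<bar>l2\<bar>" define c where "c = \<bar>f a\<bar> / \<bar>l2\<bar> ^ j"
    define e where "e = slope * l1" define d where "d = real K * B"
    have "1 < q" "0 < c" using l2 f_a' by (auto simp: q_def c_def intro!: divide_pos_pos zero_less_power)
    then have "\<forall>\<^sub>F J in at_top. e + real J * d < q ^ J * c" by real_asymp
    then show ?thesis unfolding q_def c_def e_def d_def .
  qed
  then obtain J0 where J0: "\<And>J. J \<ge> J0 \<Longrightarrow>
      slope * l1 + real J * (real K * B) < \<bar>l2\<bar> ^ J * (\<bar>f a\<bar> / \<bar>l2\<bar> ^ j)"
    unfolding eventually_at_top_linorder by blast
  have "\<not> bounded_at s B" if s: "s \<ge> l1 ^ (J0 + j)" for s
  proof
    assume bdd: "bounded_at s B"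
    define n where "n = (LEAST n. s < l1 ^ n)"
    have n: "s < l1 ^ n" unfolding n_def by (rule LeastI_ex) (rule real_arch_pow[OF l1_gt])
    have "J0 + j < n"
      using n s l1_gt by (meson le_less_trans power_less_imp_less_exp)
    then obtain J where J: "n = Suc J" "J0 + j \<le> J" by (cases n) auto
    have sJ: "l1 ^ J \<le> s" using not_less_Least[of J "\<lambda>n. s < l1 ^ n"] J unfolding n_def by simp
    define r where "r = s / l1 ^ J"
    have r: "1 \<le> r" "r < l1" using sJ n J l1_gt by (auto simp: r_def divide_simps)
    have sr: "s = r * l1 ^ J" using l1_gt by (simp add: r_def)
    \<comment> \<open>Descent to the smaller scales, followed by the ascent in \<open>main\<close>.\<close>
    have bdds: "bounded_at (r * l1 ^ i) B" if "i \<le> J" for i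
      using that
    proof (induction rule: inc_induct)
      case base
      then show ?case using bdd sr by simp
    next
      case (step i)
      have "bounded_at (r * l1 ^ Suc i / l1) B"
        using step.IH r l1_gt by (intro bounded_at_scale_down assms) auto
      then show ?case using l1_gt by simp
    qed
    have main: "i \<le> J \<Longrightarrow> legal \<theta> w \<Longrightarrow> weight g w < r * l1 ^ i \<Longrightarrow>
        \<bar>weight f w\<bar> \<le> slope * l1 + real i * (real K * B)" for i w
    proof (induction i arbitrary: w)
      case 0
      have "\<bar>weight f w\<bar> \<le> slope * weight g w" by (rule abs_weight_f_le)
      also have "\<dots> \<le> slope * l1" using 0 r by (intro mult_left_mono slope_nonneg) auto
      finally show ?case by simp
    next
      case (Suc i)
      have "l1 * (r * l1 ^ i) \<le> real (Suc K) * (r * l1 ^ i)"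
        using K r l1_gt by (intro mult_right_mono) auto
      then have "weight g w < real (Suc K) * (r * l1 ^ i)" using Suc.prems by (simp add: mult_ac)
      then have "\<bar>weight f w\<bar> \<le> (slope * l1 + real i * (real K * B)) + real K * B"
        using Suc.prems Suc.IH r l1_gt assms
        by (intro bounded_below_multiple[of "r * l1 ^ i" B]) (auto intro: bdds)
      then show ?case by (simp add: algebra_simps)
    qed
    obtain w where w: "w \<in> power_words \<theta> (J - j) [a]" using power_words_nonempty by blast
    have "weight g w = l1 ^ (J - j) * g a" using weight_eigen[OF eigen_g w] by simp
    also have "\<dots> < l1 ^ (J - j) * l1 ^ j" using j l1_gt by (intro mult_strict_left_mono) auto
    also have "\<dots> = l1 ^ J" using J by (simp flip: power_add)
    also have "\<dots> \<le> r * l1 ^ J" using r l1_gt by simp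
    finally have "\<bar>weight f w\<bar> \<le> slope * l1 + real J * (real K * B)"
      using w legal_power_words legal_letter by (intro main) auto
    moreover have "\<bar>weight f w\<bar> = \<bar>l2\<bar> ^ (J - j) * \<bar>f a\<bar>"
      using weight_eigen[OF eigen_f w] by (simp add: abs_mult power_abs)
    moreover have "\<bar>l2\<bar> ^ (J - j) * \<bar>f a\<bar> = \<bar>l2\<bar> ^ J * (\<bar>f a\<bar> / \<bar>l2\<bar> ^ j)"
      using J l2 by (simp add: power_diff)
    ultimately show False using J0[of J] J by auto
  qed
  then show ?thesis by blast
qed

text \<open>Words of equal length with almost equal letter counts have almost equal \<open>f\<close> and almost equal
  \<open>g\<close>. As \<open>f\<close> has mean zero, it is then bounded on them, and since they all have nearly the same
  size \<open>s\<close>, every legal word of size near \<open>s\<close> differs from one of them by a word of bounded size.\<close>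

theorem discrepancy_unbounded: unbounded_discrepancy
  unfolding unbounded_discrepancy_def
proof
  fix D :: nat
  define Ef where "Ef = \<bar>f a - f b\<bar>" define Eg where "Eg = \<bar>g a - g b\<bar>"
  define B where "B = max threshold (1 + D * Ef + slope * (g_max + D * Eg))"
  have nonneg: "0 \<le> Ef" "0 \<le> Eg" by (auto simp: Ef_def Eg_def)
  have "0 \<le> 1 + D * Ef + slope * (g_max + D * Eg)" using nonneg g_max_pos slope_nonneg by (intro add_nonneg_nonneg mult_nonneg_nonneg) auto
  then have B: "threshold \<le> B" "1 + D * Ef + slope * (g_max + D * Eg) \<le> B" "0 \<le> B" by (auto simp: B_def)
  obtain s0 where s0: "\<And>s. s \<ge> s0 \<Longrightarrow> \<not> bounded_at s B"
    using not_bounded_at_large[OF B(1,3)] by blast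
  obtain N0 :: nat where N0: "s0 / g_min \<le> real N0" using real_arch_simple by blast
  have "\<exists>u v. legal \<theta> u \<and> legal \<theta> v \<and> length u = n \<and> length v = n \<and>
     count_list v a + D \<le> count_list u a" if n: "n \<ge> Suc N0" for n
  proof (rule ccontr)
    assume non: "\<not> ?thesis"
    have narrow: "count_list u a < count_list v a + D"
      if "legal \<theta> u" "legal \<theta> v" "length u = n" "length v = n" for u v
      by (rule ccontr) (use that non not_less in blast)
    have diff: "\<bar>weight h u - weight h v\<bar> \<le> D * \<bar>h a - h b\<bar>"
      if uv: "legal \<theta> u" "legal \<theta> v" "length u = n" "length v = n"
      for h :: "'a \<Rightarrow> real" and u v
    proof -
      have "weight h u - weight h v = (real (count_list u a) - real (count_list v a)) * (h a - h b)"
        using uv weight_via_count[of h u] weight_via_count[of h v] by (simp add: algebra_simps)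
      moreover have "\<bar>real (count_list u a) - real (count_list v a)\<bar> \<le> D"
        using narrow[OF uv] narrow[OF uv(2,1,4,3)] by linarith
      ultimately show ?thesis by (simp add: abs_mult mult_right_mono)
    qed
    have f_n: "\<bar>weight f u\<bar> \<le> 1 + D * Ef" if u: "legal \<theta> u" "length u = n" for u
    proof -
      obtain v where v: "legal \<theta> v" "length v = n" "weight f v \<le> 1"
        using ex_legal_weight_le_1[OF eigen_f, of n] n by auto
      have "pull_weight \<theta> (\<lambda>c. - f c) c = l2 * - f c" for c
        using eigen_f[of c] by (simp add: pull_weight_def weight_uminus)
      then obtain v' where v': "legal \<theta> v'" "length v' = n" "weight (\<lambda>c. - f c) v' \<le> 1"
        using ex_legal_weight_le_1[of "\<lambda>c. - f c" n] n by auto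
      show ?thesis
        using diff[of u v f] diff[of u v' f] u v v' by (simp add: weight_uminus Ef_def)
    qed
    obtain w0 where w0: "legal \<theta> w0" "length w0 = n" using ex_legal_length by blast
    define s where "s = weight g w0"
    have "real n * g_min \<le> s"
      unfolding s_def w0(2)[symmetric] by (rule weight_bounds(1)) (auto intro: g_ge g_le)
    moreover have "s0 \<le> real N0 * g_min" using N0 g_min_pos by (simp add: divide_le_eq)
    moreover have "real N0 * g_min \<le> real n * g_min" using n g_min_pos by (intro mult_right_mono) auto
    ultimately have "s0 \<le> s" by linarith
    moreover have "bounded_at s B"
      unfolding bounded_at_def
    proof (intro allI impI)
      fix w assume w: "legal \<theta> w \<and> \<bar>weight g w - s\<bar> \<le> g_max"
      have "\<exists>u z. legal \<theta> u \<and> length u = n \<and> (w = u @ z \<or> u = w @ z)"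
      proof (cases "n \<le> length w")
        case True
        then show ?thesis
          using w legal_sublist[of \<theta> w "take n w"]
          by (intro exI[of _ "take n w"] exI[of _ "drop n w"]) auto
      next
        case False
        obtain z where "length z = n - length w" "legal \<theta> (w @ z)" using legal_extend_by w by blast
        with False show ?thesis by (intro exI[of _ "w @ z"] exI[of _ z]) auto
      qed
      then obtain u z where u: "legal \<theta> u" "length u = n" "w = u @ z \<or> u = w @ z" by blast
      have "\<bar>weight g u - s\<bar> \<le> D * Eg" using diff[of u w0 g] u w0 by (simp add: s_def Eg_def)
      then have "weight g z \<le> g_max + D * Eg" using u(3) w by auto
      then have "slope * weight g z \<le> slope * (g_max + D * Eg)" by (intro mult_left_mono slope_nonneg)
      then have "\<bar>weight f z\<bar> \<le> slope * (g_max + D * Eg)" using abs_weight_f_le[of z] by linarith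
      then show "\<bar>weight f w\<bar> \<le> B" using f_n[OF u(1,2)] u(3) B(2) by auto
    qed
    ultimately show False using s0 by blast
  qed
  then show "\<exists>N. \<forall>n\<ge>N. \<exists>u v. legal \<theta> u \<and> legal \<theta> v \<and> length u = n \<and> length v = n \<and>
     count_list v a + D \<le> count_list u a" by blast
qed

end

section \<open>Lengths of return words\<close>

context primitive_substitution
begin

text \<open>Slide a window along a legal word that contains \<open>u\<close> and later \<open>v\<close>, and stop where the number
  of \<open>a\<close> exceeds \<open>k\<close> for the first time. The last step gained exactly one \<open>a\<close>. That the boundary
  letters are always the same is what makes these words interchangeable between two fixed words.\<close>

lemma legal_window_of_each_count:
  assumes "legal \<theta> u" "legal \<theta> v" "length u = n" "length v = n"
    and "count_list u a \<le> k" "k < count_list v a"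
  shows "\<exists>x. legal \<theta> (b # x @ [a]) \<and> length (b # x) = n \<and> count_list (b # x) a = k"
proof -
  obtain z where z: "legal \<theta> (u @ z @ v)" using legal_irreducible assms by blast
  define X where "X = u @ z @ v"
  define c where "c i = count_list (take n (drop i X)) a" for i
  define N where "N = length (u @ z)"
  have "c 0 \<le> k" using assms by (simp add: c_def X_def)
  have "k < c N" using assms by (simp add: c_def X_def N_def)
  define i' where "i' = (LEAST i. k < c i)"
  have "k < c i'" unfolding i'_def using \<open>k < c N\<close> by (rule LeastI)
  have "i' \<le> N" unfolding i'_def using \<open>k < c N\<close> by (rule Least_le)
  obtain i where i: "i' = Suc i"
    using \<open>k < c i'\<close> \<open>c 0 \<le> k\<close> by (cases i') auto
  have "c i \<le> k" using not_less_Least[of i "\<lambda>i. k < c i"] i unfolding i'_def by simp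
  have len: "Suc i + n \<le> length X" using \<open>i' \<le> N\<close> i assms by (simp add: X_def N_def)
  obtain n' where n': "n = Suc n'"
    using assms(4,6) by (cases n) auto
  obtain e Y where eY: "drop i X = e # Y" using len by (cases "drop i X") auto
  have lenY: "n' < length Y" using arg_cong[OF eY, of length] len n' by simp
  have "drop (Suc i) X = Y" using eY by (metis drop_Suc list.sel(3) tl_drop)
  then have ci': "c (Suc i) = count_list (take n' Y @ [Y ! n']) a"
    using lenY n' by (simp add: c_def take_Suc_conv_app_nth)
  have ci: "c i = count_list (e # take n' Y) a" by (simp add: c_def eY n')
  have "e \<noteq> a" "Y ! n' = a" "count_list (take n' Y) a = k"
    using ci ci' \<open>c i \<le> k\<close> \<open>k < c i'\<close> i by (auto split: if_splits)
  moreover then have "e = b" using letter_cases[of e] by simp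
  moreover have "sublist (e # take n' Y @ [Y ! n']) X"
  proof -
    have "X = take i X @ (e # take n' Y @ [Y ! n']) @ drop (Suc n') Y"
      using lenY by (metis append_take_drop_id append_Cons eY take_Suc_conv_app_nth append.assoc)
    then show ?thesis by (metis sublist_appendI)
  qed
  ultimately show ?thesis
    using z lenY n' legal_sublist ab unfolding X_def by (intro exI[of _ "take n' Y"]) auto
qed

end

lemma small_integer_combination:
  fixes \<alpha> \<beta> e :: real
  assumes "0 < \<alpha>" "0 < \<beta>" "\<alpha> / \<beta> \<notin> \<rat>" "0 < e"
  shows "\<exists>p q :: int. 0 < of_int p * \<alpha> + of_int q * \<beta> \<and> of_int p * \<alpha> + of_int q * \<beta> < e"
proof -
  obtain N :: nat where N: "\<beta> / e < real N" using reals_Archimedean2 by blast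
  then have "0 < N" using assms by (cases N) (auto simp: divide_less_0_iff)
  then obtain Q P :: int where QP: "0 < Q" "\<bar>of_int Q * (\<alpha> / \<beta>) - of_int P\<bar> < 1 / N"
    by (rule Dirichlet_approx[of N "\<alpha> / \<beta>"]) auto
  define x where "x = of_int Q * \<alpha> - of_int P * \<beta>"
  have x: "x = \<beta> * (of_int Q * (\<alpha> / \<beta>) - of_int P)" using assms by (simp add: x_def field_simps)
  have "\<bar>x\<bar> = \<beta> * \<bar>of_int Q * (\<alpha> / \<beta>) - of_int P\<bar>" using assms x by (simp add: abs_mult)
  also have "\<dots> < \<beta> * (1 / N)" using QP assms by (intro mult_strict_left_mono) auto
  also have "\<dots> < e" using N assms \<open>0 < N\<close> by (simp add: field_simps)
  finally have less: "\<bar>x\<bar> < e" .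
  have "x \<noteq> 0"
  proof
    assume "x = 0"
    then have "\<alpha> / \<beta> = of_int P / of_int Q" using QP assms by (simp add: x_def field_simps)
    then show False using assms(3) by (simp add: Rats_divide)
  qed
  then consider "0 < x" | "0 < - x" by linarith
  then show ?thesis
  proof cases
    case 1
    then show ?thesis using less by (intro exI[of _ Q] exI[of _ "- P"]) (auto simp: x_def)
  next
    case 2
    then show ?thesis using less by (intro exI[of _ "- Q"] exI[of _ P]) (auto simp: x_def)
  qed
qed

text \<open>The values \<open>V n\<close> along a lattice path that follows the lower boundary \<open>lo\<close> at distance \<open>2 * H\<close>
  increase to infinity in steps \<open>\<alpha>\<close> or \<open>\<beta>\<close>. From the last value below \<open>t\<close>, at most \<open>J\<close> steps by a small
  positive combination \<open>\<eta>\<close> of \<open>\<alpha>\<close> and \<open>\<beta>\<close> reach \<open>t\<close> up to \<open>\<eta>\<close>. These steps move each coordinate by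
  at most \<open>H\<close>, so the end point stays between \<open>lo\<close> and \<open>lo + 4 * H\<close>.\<close>

lemma lattice_strip_dense:
  fixes \<alpha> \<beta> e :: real and lo :: "nat \<Rightarrow> nat"
  assumes "0 < \<alpha>" "0 < \<beta>" "\<alpha> / \<beta> \<notin> \<rat>" "0 < e"
    and lo: "\<And>n. lo n \<le> lo (Suc n)" "\<And>n. lo (Suc n) \<le> Suc (lo n)"
  shows "\<exists>D. \<forall>N. \<exists>R. \<forall>t>R. \<exists>n\<ge>N. \<exists>k. lo n \<le> k \<and> k \<le> lo n + D \<and>
    \<bar>real k * \<alpha> + (real n - real k) * \<beta> - t\<bar> < e"
proof -
  obtain p q :: int where pq: "0 < of_int p * \<alpha> + of_int q * \<beta>" "of_int p * \<alpha> + of_int q * \<beta> < e"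
    using small_integer_combination[OF assms(1-4)] by blast
  define \<eta> where "\<eta> = of_int p * \<alpha> + of_int q * \<beta>"
  have \<eta>: "0 < \<eta>" "\<eta> < e" using pq by (auto simp: \<eta>_def)
  obtain J :: nat where J: "(\<alpha> + \<beta>) / \<eta> \<le> real J" using real_arch_simple by blast
  define H :: int where "H = int J * (\<bar>p\<bar> + \<bar>q\<bar>)"
  have "0 \<le> H" by (simp add: H_def)
  define V where "V n = of_int (int (lo n) + 2 * H) * \<alpha> + (real n - of_int (int (lo n) + 2 * H)) * \<beta>" for n
  have V_Suc: "V (Suc n) = V n + (if lo (Suc n) = lo n then \<beta> else \<alpha>)" for n
  proof (cases "lo (Suc n) = lo n")
    case True
    then show ?thesis by (simp add: V_def algebra_simps)
  next
    case False
    then have "lo (Suc n) = Suc (lo n)" using lo[of n] by simp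
    then show ?thesis by (simp add: V_def algebra_simps)
  qed
  have V_mono: "mono V"
    using assms by (intro mono_iff_le_Suc[THEN iffD2] allI) (auto simp: V_Suc)
  define \<mu> where "\<mu> = min \<alpha> \<beta>"
  have "0 < \<mu>" using assms by (simp add: \<mu>_def)
  have V_lower: "V 0 + real n * \<mu> \<le> V n" for n
    by (induction n) (auto simp: V_Suc \<mu>_def algebra_simps)
  have lo_mono: "x \<le> y \<Longrightarrow> lo x \<le> lo y" for x y
    using lo(1) by (rule lift_Suc_mono_le)
  have lo_Lip: "x \<le> y \<Longrightarrow> lo y \<le> lo x + (y - x)" for x y
  proof (induction y rule: dec_induct)
    case (step y)
    then show ?case using lo(2)[of y] by linarith
  qed simp
  have "\<exists>n\<ge>N. \<exists>k. lo n \<le> k \<and> k \<le> lo n + nat (4 * H) \<and>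
    \<bar>real k * \<alpha> + (real n - real k) * \<beta> - t\<bar> < e" if t: "V (N + nat H) < t" for N t
  proof -
    define n1 where "n1 = (LEAST n. t < V n)"
    have "\<exists>n. t < V n"
    proof -
      obtain n :: nat where "(t - V 0) / \<mu> < real n" using reals_Archimedean2 by blast
      then have "t < V 0 + real n * \<mu>" using \<open>0 < \<mu>\<close> by (simp add: divide_less_eq)
      then show ?thesis using V_lower[of n] by (intro exI[of _ n]) linarith
    qed
    then have n1: "t < V n1" unfolding n1_def by (rule LeastI_ex)
    have "N + nat H < n1"
      using t n1 monoD[OF V_mono, of n1 "N + nat H"] by force
    then obtain n0 where n0: "n1 = Suc n0" "N + nat H \<le> n0" by (cases n1) auto
    have Vn0: "V n0 \<le> t" using not_less_Least[of n0 "\<lambda>n. t < V n"] n0 unfolding n1_def by simp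
    have Vn0': "t - V n0 < \<alpha> + \<beta>" using n1 n0 assms by (auto simp: V_Suc split: if_splits)
    define j where "j = \<lfloor>(t - V n0) / \<eta>\<rfloor>"
    have j: "of_int j * \<eta> \<le> t - V n0" "t - V n0 < (of_int j + 1) * \<eta>"
      using \<eta> floor_divide_lower[of \<eta> "t - V n0"] floor_divide_upper[of \<eta> "t - V n0"]
      by (auto simp: j_def)
    have "0 \<le> j" using Vn0 \<eta> by (simp add: j_def)
    have "(t - V n0) / \<eta> \<le> (\<alpha> + \<beta>) / \<eta>" using Vn0' \<eta> by (intro divide_right_mono) auto
    then have "j \<le> int J" using J unfolding j_def by linarith
    then have jpq: "j * \<bar>p\<bar> + j * \<bar>q\<bar> \<le> H"
      unfolding H_def distrib_left[symmetric] by (intro mult_right_mono) auto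
    have jp: "\<bar>j * p\<bar> \<le> j * \<bar>p\<bar>" "\<bar>j * q\<bar> \<le> j * \<bar>q\<bar>" using \<open>0 \<le> j\<close> by (auto simp: abs_mult)
    have pos: "0 \<le> j * \<bar>p\<bar>" "0 \<le> j * \<bar>q\<bar>" using \<open>0 \<le> j\<close> by auto
    define n where "n = nat (int n0 + j * p + j * q)"
    define k where "k = nat (int (lo n0) + 2 * H + j * p)"
    have n: "int n = int n0 + j * p + j * q" using n0 jpq jp by (simp add: n_def)
    have k: "int k = int (lo n0) + 2 * H + j * p" using jpq jp pos \<open>0 \<le> H\<close> by (simp add: k_def)
    have near: "\<bar>int n - int n0\<bar> \<le> H" using n jpq jp by linarith
    have "\<bar>int (lo n) - int (lo n0)\<bar> \<le> H"
      using near lo_mono[of n n0] lo_mono[of n0 n] lo_Lip[of n n0] lo_Lip[of n0 n]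
      by (cases "n \<le> n0") linarith+
    then have "lo n \<le> k" "k \<le> lo n + nat (4 * H)" using k jpq jp pos by linarith+
    moreover have "N \<le> n" using near n0 by linarith
    moreover have "\<bar>real k * \<alpha> + (real n - real k) * \<beta> - t\<bar> < e"
    proof -
      have "real k = of_int (int (lo n0) + 2 * H) + of_int j * of_int p"
        using arg_cong[OF k, of real_of_int] by simp
      moreover have "real n = real n0 + of_int j * of_int p + of_int j * of_int q"
        using arg_cong[OF n, of real_of_int] by simp
      ultimately have "real k * \<alpha> + (real n - real k) * \<beta> = V n0 + of_int j * \<eta>"
        by (simp add: V_def \<eta>_def algebra_simps)
      then show ?thesis using j \<eta> by (simp add: algebra_simps)
    qed
    ultimately show ?thesis by blast
  qed
  then show ?thesis by blast
qed

context primitive_substitution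
begin

text \<open>The boundary of the strip is the least number of \<open>a\<close> in a legal word of given length. It
  grows by at most one with the length because legal words can be shortened and prolonged by a
  letter, and by the discrepancy the strip is eventually wider than the width \<open>D\<close> needed for the
  accuracy \<open>e\<close>.\<close>

lemma return_weights_dense:
  assumes disc: unbounded_discrepancy
    and "0 < h a" "0 < h b" "h a / h b \<notin> \<rat>" "0 < e"
  shows "\<exists>R. \<forall>t>R. \<exists>x. legal \<theta> (b # x @ [a]) \<and> \<bar>weight h (b # x) - t\<bar> < e"
proof -
  define count where "count n k \<longleftrightarrow> (\<exists>w. legal \<theta> w \<and> length w = n \<and> count_list w a = k)" for n k
  define lo where "lo n = (LEAST k. count n k)" for n
  have "\<exists>k. count n k" for n using ex_legal_length unfolding count_def by blast
  then have "count n (lo n)" for n unfolding lo_def by (rule LeastI_ex)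
  then have lo_word: "\<exists>w. legal \<theta> w \<and> length w = n \<and> count_list w a = lo n" for n
    by (simp add: count_def)
  have lo_le: "lo (length w) \<le> count_list w a" if "legal \<theta> w" for w
    unfolding lo_def by (rule Least_le) (use that in \<open>auto simp: count_def\<close>)
  have lo1: "lo n \<le> lo (Suc n)" for n
  proof -
    obtain w where w: "legal \<theta> w" "length w = Suc n" "count_list w a = lo (Suc n)"
      using lo_word by blast
    then obtain d w' where "w = d # w'" by (cases w) auto
    then have "legal \<theta> w'" "length w' = n" "count_list w' a \<le> lo (Suc n)"
      using w legal_sublist[OF w(1), of w'] by (auto simp: sublist_Cons_right split: if_splits)
    then show ?thesis using lo_le[of w'] by simp
  qed
  have lo2: "lo (Suc n) \<le> Suc (lo n)" for n
  proof -
    obtain w where w: "legal \<theta> w" "length w = n" "count_list w a = lo n"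
      using lo_word by blast
    then obtain d where "legal \<theta> (d # w)" using legal_extend_left by blast
    then show ?thesis using lo_le[of "d # w"] w by (auto split: if_splits)
  qed
  obtain D where D: "\<And>N. \<exists>R. \<forall>t>R. \<exists>n\<ge>N. \<exists>k. lo n \<le> k \<and> k \<le> lo n + D \<and>
      \<bar>real k * h a + (real n - real k) * h b - t\<bar> < e"
    using lattice_strip_dense[OF assms(2-5), of lo] lo1 lo2 by blast
  obtain N where N: "\<And>n. n \<ge> N \<Longrightarrow> \<exists>u v. legal \<theta> u \<and> legal \<theta> v \<and> length u = n \<and> length v = n \<and>
      count_list v a + Suc D \<le> count_list u a"
    using disc unfolding unbounded_discrepancy_def by blast
  obtain R where R: "\<And>t. t > R \<Longrightarrow> \<exists>n\<ge>N. \<exists>k. lo n \<le> k \<and> k \<le> lo n + D \<and>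
      \<bar>real k * h a + (real n - real k) * h b - t\<bar> < e"
    using D[of N] by blast
  have "\<exists>x. legal \<theta> (b # x @ [a]) \<and> \<bar>weight h (b # x) - t\<bar> < e" if t: "t > R" for t
  proof -
    obtain n k where nk: "n \<ge> N" "lo n \<le> k" "k \<le> lo n + D"
      "\<bar>real k * h a + (real n - real k) * h b - t\<bar> < e"
      using R[OF t] by blast
    obtain u v where uv: "legal \<theta> u" "legal \<theta> v" "length u = n" "length v = n"
      "count_list v a + Suc D \<le> count_list u a"
      using N[OF nk(1)] by blast
    obtain w where w: "legal \<theta> w" "length w = n" "count_list w a = lo n" using lo_word by blast
    have "k < count_list u a" using uv lo_le[of v] nk by auto
    then obtain x where x: "legal \<theta> (b # x @ [a])" "length (b # x) = n" "count_list (b # x) a = k"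
      using legal_window_of_each_count[of w u n k] w uv nk by auto
    have "weight h (b # x) = real k * h a + (real n - real k) * h b"
      using weight_via_count[of h "b # x"] by (simp only: x)
    then show ?thesis using nk x by metis
  qed
  then show ?thesis by blast
qed

text \<open>The columns of the substitution matrix are the letter counts of images of \<open>a\<close> and \<open>b\<close>; the
  hypothesis \<open>det\<close> says that its determinant is not zero, so it preserves rational independence.\<close>

lemma pull_weight_independent:
  assumes det: "count_list (SOME w. w \<in> \<theta> a) a * count_list (SOME w. w \<in> \<theta> b) b \<noteq>
      count_list (SOME w. w \<in> \<theta> a) b * count_list (SOME w. w \<in> \<theta> b) a"
    and h: "0 < h a" "0 < h b" "h a / h b \<notin> \<rat>"
  shows "0 < pull_weight \<theta> h a \<and> 0 < pull_weight \<theta> h b \<and>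
    pull_weight \<theta> h a / pull_weight \<theta> h b \<notin> \<rat>"
proof -
  define u v where "u = (SOME w. w \<in> \<theta> a)" and "v = (SOME w. w \<in> \<theta> b)"
  define A B where "A = count_list u a" and "B = count_list u b"
  define C D where "C = count_list v a" and "D = count_list v b"
  have hA: "pull_weight \<theta> h a = A * h a + B * h b" and hB: "pull_weight \<theta> h b = C * h a + D * h b"
    by (simp_all add: pull_weight_def weight_two_letters[OF ab UNIV_ab] u_def v_def A_def B_def C_def D_def)
  have det': "A * D \<noteq> B * C" using det by (simp add: A_def B_def C_def D_def u_def v_def)
  have "A \<noteq> 0 \<or> B \<noteq> 0" "C \<noteq> 0 \<or> D \<noteq> 0" using det' by auto
  then have pos: "0 < pull_weight \<theta> h a" "0 < pull_weight \<theta> h b"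
    unfolding hA hB using h by (auto intro: add_pos_nonneg add_nonneg_pos)
  have "pull_weight \<theta> h a / pull_weight \<theta> h b \<notin> \<rat>"
  proof
    assume "pull_weight \<theta> h a / pull_weight \<theta> h b \<in> \<rat>"
    then obtain r s :: int where rs: "s > 0" "pull_weight \<theta> h a / pull_weight \<theta> h b = of_int r / of_int s"
      by (metis Rats_cases')
    then have "of_int s * (A * h a + B * h b) = of_int r * (C * h a + D * h b)"
      using pos by (simp add: hA hB field_simps)
    then have eq: "of_int (s * int A - r * int C) * h a = of_int (r * int D - s * int B) * h b"
      by (simp add: algebra_simps)
    show False
    proof (cases "s * int A - r * int C = 0")
      case True
      then have "(of_int (r * int D - s * int B) :: real) = 0"
        using eq h by (simp del: of_int_diff of_int_mult)
      then have "r * int D - s * int B = 0" by (simp only: of_int_eq_0_iff)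
      moreover have "s * (int A * int D) - s * (int B * int C) =
          (s * int A - r * int C) * int D + (r * int D - s * int B) * int C"
        by (simp add: algebra_simps)
      ultimately have "s * (int A * int D) = s * (int B * int C)" by (simp add: True)
      then have "int (A * D) = int (B * C)" using rs(1) by simp
      then show False using det' by (simp only: of_nat_eq_iff)
    next
      case False
      then have "h a / h b = of_int (r * int D - s * int B) / of_int (s * int A - r * int C)"
        using eq h by (simp add: field_simps del: of_int_diff of_int_mult)
      then show False using h(3) by (simp add: Rats_divide del: of_int_diff of_int_mult)
    qed
  qed
  with pos show ?thesis by blast
qed

text \<open>Choose \<open>k\<close> such that \<open>u\<close> occurs in a word of \<open>\<theta>^k(b)\<close> and \<open>v\<close> in a word of \<open>\<theta>^k(a)\<close>. Applying
  \<open>\<theta>^k\<close> to a legal word \<open>b x a\<close> produces \<open>u\<close> and \<open>v\<close> at a distance that is, up to a constant, the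
  weight of \<open>b x\<close> for the \<open>k\<close>-fold pull-back of \<open>h\<close>.\<close>

lemma legal_words_at_distance:
  assumes disc: unbounded_discrepancy
    and det: "count_list (SOME w. w \<in> \<theta> a) a * count_list (SOME w. w \<in> \<theta> b) b \<noteq>
      count_list (SOME w. w \<in> \<theta> a) b * count_list (SOME w. w \<in> \<theta> b) a"
    and h: "0 < h a" "0 < h b" "h a / h b \<notin> \<rat>"
    and uv: "legal \<theta> u" "legal \<theta> v" and e: "0 < e"
  shows "\<exists>R. \<forall>t>R. \<exists>s. legal \<theta> (u @ s @ v) \<and> \<bar>weight h (u @ s) - t\<bar> < e"
proof -
  obtain k where k: "\<And>c. \<exists>w\<in>power_words \<theta> k [c]. sublist u w"
    "\<And>c. \<exists>w\<in>power_words \<theta> k [c]. sublist v w"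
    using uv[THEN legal_occurs_eventually] by (metis max.cobounded1 max.cobounded2)
  obtain x1 x2 y1 y2 where xy: "x1 @ u @ x2 \<in> power_words \<theta> k [b]"
    "y1 @ v @ y2 \<in> power_words \<theta> k [a]"
    using k unfolding sublist_def by metis
  define H where "H = (pull_weight \<theta> ^^ k) h"
  have "0 < ((pull_weight \<theta> ^^ i) h) a \<and> 0 < ((pull_weight \<theta> ^^ i) h) b \<and>
      ((pull_weight \<theta> ^^ i) h) a / ((pull_weight \<theta> ^^ i) h) b \<notin> \<rat>" for i
    by (induction i) (use h pull_weight_independent[OF det] in auto)
  then have "0 < H a" "0 < H b" "H a / H b \<notin> \<rat>" by (auto simp: H_def)
  then obtain R where R: "\<And>t. t > R \<Longrightarrow>
      \<exists>x. legal \<theta> (b # x @ [a]) \<and> \<bar>weight H (b # x) - t\<bar> < e"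
    using return_weights_dense[OF disc] e by blast
  have "\<exists>s. legal \<theta> (u @ s @ v) \<and> \<bar>weight h (u @ s) - t\<bar> < e"
    if t: "t > R - weight h x1 + weight h y1" for t
  proof -
    obtain x where x: "legal \<theta> (b # x @ [a])" "\<bar>weight H (b # x) - (t + weight h x1 - weight h y1)\<bar> < e"
      using R[of "t + weight h x1 - weight h y1"] t by auto
    obtain x' where x': "x' \<in> power_words \<theta> k x" using power_words_nonempty by blast
    have pre: "(x1 @ u @ x2) @ x' \<in> power_words \<theta> k ([b] @ x)"
      using xy x' by (intro power_words_appendI)
    have "((x1 @ u @ x2) @ x') @ (y1 @ v @ y2) \<in> power_words \<theta> k (([b] @ x) @ [a])"
      by (rule power_words_appendI[OF pre xy(2)])
    then have "legal \<theta> (((x1 @ u @ x2) @ x') @ (y1 @ v @ y2))"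
      using legal_power_words[OF x(1)] by simp
    then have "legal \<theta> (u @ (x2 @ x' @ y1) @ v)"
      by (rule legal_sublist) (auto simp: sublist_def)
    moreover have "weight h (u @ x2 @ x' @ y1) = weight H (b # x) - weight h x1 + weight h y1"
      using weight_power_words[OF pre, of h] by (simp add: H_def)
    ultimately show ?thesis using x(2) by (intro exI[of _ "x2 @ x' @ y1"]) auto
  qed
  then show ?thesis by blast
qed

end

section \<open>From the substitution matrix to eigenweights\<close>

locale two_letter_substitution = compatible_substitution \<theta>
  for \<theta> :: "'a \<Rightarrow> 'a list set" +
  fixes a b :: 'a
  assumes ab: "a \<noteq> b" and UNIV_ab: "(UNIV :: 'a set) = {a, b}"
    and primitive_matrix: "primitive_mat (subst_matrix [a, b] \<theta>)"
begin

text \<open>The matrix \<open>M\<close> has the rows \<open>(A, C)\<close> and \<open>(B, D)\<close>.\<close>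

definition "M = subst_matrix [a, b] \<theta>"
definition "A = count_list (SOME w. w \<in> \<theta> a) a"
definition "B = count_list (SOME w. w \<in> \<theta> a) b"
definition "C = count_list (SOME w. w \<in> \<theta> b) a"
definition "D = count_list (SOME w. w \<in> \<theta> b) b"

lemma M_carrier: "M \<in> carrier_mat 2 2"
  by (simp add: M_def subst_matrix_def numeral_2_eq_2)

lemma M_entries: "M $$ (0, 0) = A" "M $$ (1, 0) = B" "M $$ (0, 1) = C" "M $$ (1, 1) = D"
  by (simp_all add: M_def subst_matrix_def A_def B_def C_def D_def)

lemma pull_weight_entries:
  "pull_weight \<theta> h a = real A * h a + real B * h b"
  "pull_weight \<theta> h b = real C * h a + real D * h b"
  by (simp_all add: pull_weight_def weight_two_letters[OF ab UNIV_ab] A_def B_def C_def D_def)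

lemma pow_Suc_entry:
  assumes "i < 2" "j < 2"
  shows "(M ^\<^sub>m Suc k) $$ (i, j) = (M ^\<^sub>m k) $$ (i, 0) * M $$ (0, j) + (M ^\<^sub>m k) $$ (i, 1) * M $$ (1, j)"
proof -
  have "M ^\<^sub>m k \<in> carrier_mat 2 2" using M_carrier by (rule pow_carrier_mat)
  then show ?thesis using assms M_carrier
    by (auto simp: scalar_prod_def numeral_2_eq_2)
qed

lemma pow_0_entry: "i < 2 \<Longrightarrow> j < 2 \<Longrightarrow> (M ^\<^sub>m 0) $$ (i, j) = (if i = j then 1 else 0)"
  using M_carrier by auto

text \<open>Pulling back the indicator of the letter with index \<open>i\<close> iterates the transposed matrix on a unit
  vector, so it gives the row \<open>i\<close> of the power of \<open>M\<close>.\<close>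

lemma pull_weight_power_indicator:
  assumes "i < 2"
  shows "(pull_weight \<theta> ^^ k) (\<lambda>c. if c = [a, b] ! i then 1 else 0) a = real ((M ^\<^sub>m k) $$ (i, 0)) \<and>
    (pull_weight \<theta> ^^ k) (\<lambda>c. if c = [a, b] ! i then 1 else 0) b = real ((M ^\<^sub>m k) $$ (i, 1))"
proof (induction k)
  case 0
  have "i = 0 \<or> i = 1" using assms by auto
  then show ?case using ab by (auto simp: pow_0_entry simp del: pow_mat.simps)
next
  case (Suc k)
  then show ?case
    using assms by (simp add: pull_weight_entries pow_Suc_entry M_entries algebra_simps
        del: pow_mat.simps One_nat_def)
qed

lemma ex_primitive_power: "\<exists>p. \<forall>c d. \<forall>w\<in>power_words \<theta> p [c]. d \<in> set w"
proof -
  obtain p where p: "\<And>i j. i < 2 \<Longrightarrow> j < 2 \<Longrightarrow> 0 < (M ^\<^sub>m p) $$ (i, j)"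
    using primitive_matrix M_carrier unfolding primitive_mat_def M_def[symmetric] by auto
  have "d \<in> set w" if w: "w \<in> power_words \<theta> p [c]" for c d w
  proof (rule ccontr)
    assume d: "d \<notin> set w"
    have "d = a \<or> d = b" using UNIV_ab by auto
    then have "d = [a, b] ! 0 \<or> d = [a, b] ! 1" by simp
    then obtain i :: nat where i: "i < 2" "d = [a, b] ! i"
      by (elim disjE) (rule that[of 0], simp, simp, rule that[of 1], simp, simp)
    have "weight (\<lambda>c. if c = d then 1 else 0) w = 0"
      using d by (induction w) auto
    then have "(pull_weight \<theta> ^^ p) (\<lambda>c. if c = d then 1 else 0) c = 0"
      using weight_power_words[OF w] by simp
    moreover have "c = a \<or> c = b" using UNIV_ab by auto
    ultimately show False
      using pull_weight_power_indicator[OF i(1), of p] p[OF i(1), of 0] p[OF i(1), of 1] i(2) by auto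
  qed
  then show ?thesis by blast
qed

text \<open>A matrix that is triangular has only triangular powers, and a matrix with zero diagonal has
  powers whose diagonal or antidiagonal vanishes, so no power of them is positive.\<close>

lemma entries_pos: "0 < B" "0 < C" "0 < A + D"
proof -
  obtain k' where k: "\<And>i j. i < 2 \<Longrightarrow> j < 2 \<Longrightarrow> 0 < (M ^\<^sub>m k') $$ (i, j)"
    using primitive_matrix M_carrier unfolding primitive_mat_def M_def[symmetric] by auto
  note simps = pow_0_entry pow_Suc_entry M_entries
  show "0 < B"
  proof (rule ccontr)
    assume "\<not> 0 < B"
    then have "(M ^\<^sub>m n) $$ (1, 0) = 0" for n
      by (induction n) (simp_all add: simps del: pow_mat.simps One_nat_def)
    then show False using k[of 1 0] by simp
  qed
  show "0 < C"
  proof (rule ccontr)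
    assume "\<not> 0 < C"
    then have "(M ^\<^sub>m n) $$ (0, 1) = 0" for n
      by (induction n) (simp_all add: simps del: pow_mat.simps One_nat_def)
    then show False using k[of 0 1] by simp
  qed
  show "0 < A + D"
  proof (rule ccontr)
    assume "\<not> 0 < A + D"
    then have zeros: "((M ^\<^sub>m n) $$ (0, 0) = 0 \<and> (M ^\<^sub>m n) $$ (1, 1) = 0) \<or>
        ((M ^\<^sub>m n) $$ (0, 1) = 0 \<and> (M ^\<^sub>m n) $$ (1, 0) = 0)" for n
      by (induction n) (auto simp: simps simp del: pow_mat.simps One_nat_def)
    show False using k[of 0 0] k[of 0 1] zeros[of k'] by simp
  qed
qed

lemma eigenvalue_characteristic:
  assumes "eigenvalue (map_mat of_nat M) \<mu>"
  shows "(\<mu> - of_nat A) * (\<mu> - of_nat D) = (of_nat (B * C) :: complex)"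
proof -
  define N where "N = (map_mat of_nat M :: complex mat)"
  have N: "N \<in> carrier_mat 2 2" using M_carrier by (simp add: N_def)
  have entries: "N $$ (0, 0) = of_nat A" "N $$ (1, 0) = of_nat B"
    "N $$ (0, 1) = of_nat C" "N $$ (1, 1) = of_nat D"
    using M_carrier M_entries by (auto simp: N_def)
  obtain v where v: "v \<in> carrier_vec 2" "v \<noteq> 0\<^sub>v 2" "N *\<^sub>v v = \<mu> \<cdot>\<^sub>v v"
    using assms N unfolding eigenvalue_def eigenvector_def N_def[symmetric] by auto
  have row: "(N *\<^sub>v v) $ i = N $$ (i, 0) * v $ 0 + N $$ (i, 1) * v $ 1" if "i < 2" for i
    using that N v(1) by (auto simp: scalar_prod_def numeral_2_eq_2)
  have e0: "of_nat A * v $ 0 + of_nat C * v $ 1 = \<mu> * v $ 0"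
    and e1: "of_nat B * v $ 0 + of_nat D * v $ 1 = \<mu> * v $ 1"
    using row[of 0] row[of 1] v entries by auto
  have "v $ 0 \<noteq> 0 \<or> v $ 1 \<noteq> 0"
  proof (rule ccontr)
    assume "\<not> ?thesis"
    then have "v = 0\<^sub>v 2" using v(1) by (intro eq_vecI) (auto simp: less_2_cases_iff)
    with v(2) show False by blast
  qed
  moreover have "((\<mu> - of_nat A) * (\<mu> - of_nat D) - of_nat (B * C)) * v $ 0 = 0"
  proof -
    have "((\<mu> - of_nat A) * (\<mu> - of_nat D) - of_nat (B * C)) * v $ 0 =
      (\<mu> - of_nat D) * (\<mu> * v $ 0 - (of_nat A * v $ 0 + of_nat C * v $ 1)) +
      of_nat C * (\<mu> * v $ 1 - (of_nat B * v $ 0 + of_nat D * v $ 1))"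
      by (simp add: algebra_simps)
    then show ?thesis unfolding e0 e1 by simp
  qed
  moreover have "((\<mu> - of_nat A) * (\<mu> - of_nat D) - of_nat (B * C)) * v $ 1 = 0"
  proof -
    have "((\<mu> - of_nat A) * (\<mu> - of_nat D) - of_nat (B * C)) * v $ 1 =
      (\<mu> - of_nat A) * (\<mu> * v $ 1 - (of_nat B * v $ 0 + of_nat D * v $ 1)) +
      of_nat B * (\<mu> * v $ 0 - (of_nat A * v $ 0 + of_nat C * v $ 1))"
      by (simp add: algebra_simps)
    then show ?thesis unfolding e0 e1 by simp
  qed
  ultimately show ?thesis by auto
qed

text \<open>The discriminant \<open>(A - D)\<^sup>2 + 4 B C\<close> and the trace are positive, so the eigenvalues are real and
  the larger one, \<open>l1\<close>, strictly dominates in modulus. Hence \<open>l1\<close> can only be an eigenvalue by being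
  the spectral radius, and an eigenvalue different from the spectral radius is \<open>l2\<close>.\<close>

lemma real_eigenvalues:
  assumes "second_eigenvalue M \<mu>"
  shows "\<exists>l1 l2 :: real. \<mu> = of_real l2 \<and> \<bar>l2\<bar> < l1 \<and> real A < l1 \<and> l1 * l2 = real A * real D - real B * real C \<and>
    (\<forall>l\<in>{l1, l2}. (l - A) * (l - D) = real B * real C)"
proof -
  define s where "s = sqrt ((real A - D)\<^sup>2 + 4 * (real B * C))"
  have BC: "0 < real B * real C" using entries_pos by simp
  have s2: "s\<^sup>2 = (real A - D)\<^sup>2 + 4 * (real B * C)"
    unfolding s_def using BC by (intro real_sqrt_pow2 add_nonneg_nonneg) auto
  have s_gt: "\<bar>real A - D\<bar> < s"
    unfolding s_def using BC by (intro real_less_rsqrt) auto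
  define l1 where "l1 = (real A + D + s) / 2"
  define l2 where "l2 = (real A + D - s) / 2"
  have "l1 * l2 = ((real A + D)\<^sup>2 - s\<^sup>2) / 4"
    by (simp add: l1_def l2_def power2_eq_square algebra_simps)
  also have "\<dots> = real A * D - real B * C"
    unfolding s2 by (simp add: power2_eq_square field_simps)
  finally have sumprod: "l1 + l2 = real A + D" "l1 * l2 = real A * D - real B * C"
    by (simp_all add: l1_def l2_def field_simps)
  have "0 < s" "0 < real A + real D" using s_gt entries_pos(3) by linarith+
  then have l2_lt: "\<bar>l2\<bar> < l1" by (simp add: abs_less_iff l1_def l2_def field_simps)
  have "real A < l1" using s_gt by (simp add: l1_def)
  have char: "(l - A) * (l - D) = real B * real C" if "l \<in> {l1, l2}" for l
  proof -
    have "(l - l1) * (l - l2) = 0" using that by auto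
    then have "l * l - (l1 + l2) * l + l1 * l2 = 0" by (simp add: algebra_simps)
    then show ?thesis unfolding sumprod by (simp add: algebra_simps)
  qed
  have roots: "\<nu> = of_real l1 \<or> \<nu> = of_real l2" if "eigenvalue (map_mat of_nat M) \<nu>" for \<nu> :: complex
  proof -
    have "(\<nu> - of_real l1) * (\<nu> - of_real l2) =
        \<nu> * \<nu> - of_real (l1 + l2) * \<nu> + of_real (l1 * l2)" by (simp add: algebra_simps)
    also have "\<dots> = (\<nu> - of_nat A) * (\<nu> - of_nat D) - of_nat (B * C)"
      unfolding sumprod by (simp add: algebra_simps)
    also have "\<dots> = 0" using eigenvalue_characteristic[OF that] by simp
    finally show ?thesis by auto
  qed
  have ev: "eigenvalue (map_mat of_nat M) \<mu>"
    and ne: "\<mu> \<noteq> complex_of_real (spectral_radius (map_mat of_nat M))"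
    using assms by (auto simp: second_eigenvalue_def)
  have "\<mu> \<noteq> of_real l1"
  proof
    assume \<mu>: "\<mu> = of_real l1"
    have car: "(map_mat of_nat M :: complex mat) \<in> carrier_mat 2 2" using M_carrier by simp
    have "l1 \<in> norm ` spectrum (map_mat of_nat M :: complex mat)"
      using ev l2_lt unfolding \<mu> spectrum_def by (intro image_eqI[of _ _ "of_real l1"]) auto
    then have "l1 \<le> spectral_radius (map_mat of_nat M)"
      by (rule spectral_radius_mem_max(2)[OF car pos2])
    moreover obtain \<nu> where "eigenvalue (map_mat of_nat M) \<nu>"
      "spectral_radius (map_mat of_nat M) = norm (\<nu> :: complex)"
      using spectral_radius_mem_max(1)[OF car pos2] by (auto simp: spectrum_def)
    ultimately have "spectral_radius (map_mat of_nat M) = l1"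
      using roots[of \<nu>] l2_lt by auto
    with ne \<mu> show False by simp
  qed
  then have "\<mu> = of_real l2" using roots[OF ev] by blast
  with l2_lt \<open>real A < l1\<close> char sumprod show ?thesis by blast
qed

lemma ex_expanding:
  assumes "second_eigenvalue M \<mu>" "1 < cmod \<mu>"
  shows "\<exists>p g f l1 l2. expanding_substitution \<theta> a b p g f l1 l2"
    and "A * D \<noteq> B * C"
proof -
  obtain l1 l2 :: real where l: "\<mu> = of_real l2" "\<bar>l2\<bar> < l1" "real A < l1" "l1 * l2 = real A * real D - real B * real C"
    "\<forall>l\<in>{l1, l2}. (l - A) * (l - D) = real B * real C"
    using real_eigenvalues[OF assms(1)] by auto
  have l2: "1 < \<bar>l2\<bar>" using assms(2) l(1) by simp
  have "l1 * l2 \<noteq> 0" using l2 l(2) by auto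
  then show "A * D \<noteq> B * C" using l(4) by (auto simp flip: of_nat_mult)
  obtain p where p: "\<And>c d w. w \<in> power_words \<theta> p [c] \<Longrightarrow> d \<in> set w"
    using ex_primitive_power by blast
  \<comment> \<open>The left eigenvector \<open>(B, l - A)\<close>; for \<open>l1\<close> it is positive because \<open>A < l1\<close>.\<close>
  define e where "e l c = (if c = a then real B else l - A)" for l :: real and c :: 'a
  have cases: "c = a \<or> c = b" for c using UNIV_ab by auto
  have eigen: "pull_weight \<theta> (e l) c = l * e l c" if "l \<in> {l1, l2}" for l c
  proof -
    have "(l - A) * (l - D) = real B * real C" using l(5) that by blast
    then show ?thesis
      using cases[of c] ab by (auto simp: pull_weight_entries e_def algebra_simps)
  qed
  have "expanding_substitution \<theta> a b p (e l1) (e l2) l1 l2"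
  proof unfold_locales
    show "a \<noteq> b" "UNIV = {a, b}" by (rule ab, rule UNIV_ab)
    show "d \<in> set w" if "w \<in> power_words \<theta> p [c]" for w c d using that by (rule p)
    show "pull_weight \<theta> (e l1) c = l1 * e l1 c" "pull_weight \<theta> (e l2) c = l2 * e l2 c" for c
      by (rule eigen, simp)+
    show "0 < e l1 c" for c using entries_pos(1) l(3) by (simp add: e_def)
    show "e l2 a \<noteq> 0" using entries_pos(1) by (simp add: e_def)
    show "1 < \<bar>l2\<bar>" "\<bar>l2\<bar> < l1" by (rule l2, rule l(2))
  qed
  then show "\<exists>p g f l1 l2. expanding_substitution \<theta> a b p g f l1 l2" by blast
qed

end

section \<open>Tilings through a given legal word\<close>

lemma word_patch_Nil [simp]: "word_patch len x [] = {}"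
  by (simp add: word_patch_def)

lemma word_patch_Cons: "word_patch len x (c # w) = insert (x, c) (word_patch len (x + len c) w)"
proof -
  have "{i. i < length (c # w)} = insert 0 (Suc ` {i. i < length w})"
    by (auto simp: less_Suc_eq_0_disj image_iff)
  then have "(\<lambda>i. (x + (\<Sum>j<i. len ((c # w) ! j)), (c # w) ! i)) ` {i. i < length (c # w)} =
    insert (x, c) ((\<lambda>i. (x + len c + (\<Sum>j<i. len (w ! j)), w ! i)) ` {i. i < length w})"
    by (simp add: image_image sum.lessThan_Suc_shift add.assoc del: sum.lessThan_Suc)
  then show ?thesis by (simp add: word_patch_def image_Collect)
qed

lemma word_patch_append:
  "word_patch len x (u @ v) = word_patch len x u \<union> word_patch len (x + weight len u) v"
  by (induction u arbitrary: x) (auto simp: word_patch_Cons add.assoc)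

lemma translate_translate: "translate s (translate t S) = translate (s + t) S"
  by (auto simp: translate_def image_image split_beta algebra_simps)

lemma translate_0 [simp]: "translate 0 S = S"
  by (auto simp: translate_def)

lemma translate_mono: "S \<subseteq> S' \<Longrightarrow> translate t S \<subseteq> translate t S'"
  by (auto simp: translate_def)

lemma translate_subset_iff: "translate t P \<subseteq> S \<longleftrightarrow> P \<subseteq> translate (- t) S"
  using translate_mono[of "translate t P" S "- t"] translate_mono[of P "translate (- t) S" t]
  by (auto simp: translate_translate)

lemma translate_word_patch: "translate t (word_patch len x w) = word_patch len (x - t) w"
proof (induction w arbitrary: x)
  case (Cons c w)
  have "translate t (insert (x, c) S) = insert (x - t, c) (translate t S)" for S :: "'a tile set"
    by (simp add: translate_def)
  then show ?case using Cons[of "x + len c"] by (simp add: word_patch_Cons algebra_simps)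
qed (simp add: translate_def)

lemma word_patch_window:
  fixes q :: "int \<Rightarrow> real" and z :: "int \<Rightarrow> 'a"
  assumes "\<And>i. q (i + 1) = q i + len (z i)"
  shows "word_patch len (q i) (map (\<lambda>j. z (i + int j)) [0..<n]) =
    (\<lambda>i. (q i, z i)) ` {i..<i + int n}"
proof (induction n arbitrary: i)
  case (Suc n)
  have "map (\<lambda>j. z (i + int j)) [0..<Suc n] = z i # map (\<lambda>j. z ((i + 1) + int j)) [0..<n]"
    by (simp add: upt_conv_Cons map_Suc_upt[symmetric] add_ac del: upt_Suc)
  then have "word_patch len (q i) (map (\<lambda>j. z (i + int j)) [0..<Suc n]) =
    insert (q i, z i) ((\<lambda>i. (q i, z i)) ` {i + 1..<i + 1 + int n})"
    using Suc[of "i + 1"] by (simp only: word_patch_Cons assms[symmetric])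
  also have "\<dots> = (\<lambda>i. (q i, z i)) ` insert i {i + 1..<i + 1 + int n}" by simp
  also have "insert i {i + 1..<i + 1 + int n} = {i..<i + int (Suc n)}" by auto
  finally show ?case .
qed simp

text \<open>Tile positions are strictly increasing, so the position of a tile determines its index and, by
  induction, a patch can only continue by the next tile of the tiling.\<close>

lemma patch_in_tiling_is_window:
  fixes q :: "int \<Rightarrow> real" and z :: "int \<Rightarrow> 'a"
  assumes q: "\<And>i. q (i + 1) = q i + len (z i)" and len: "\<And>c. 0 < len c"
    and "word_patch len x w \<subseteq> range (\<lambda>i. (q i, z i))"
  shows "\<exists>i. w = map (\<lambda>j. z (i + int j)) [0..<length w]"
proof -
  have "q i < q (i + int (Suc n))" for i n
  proof (induction n)
    case (Suc n)
    then show ?case using q[of "i + int (Suc n)"] len[of "z (i + int (Suc n))"] by (simp add: add_ac)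
  qed (use q len in simp)
  then have less: "q i < q j" if "i < j" for i j
    using that zless_iff_Suc_zadd by (metis add.commute)
  have inj: "q i = q j \<longleftrightarrow> i = j" for i j
    using less[of i j] less[of j i] by (cases i j rule: linorder_cases) auto
  have "w = map (\<lambda>j. z (i + int j)) [0..<length w]"
    if "word_patch len (q i) w \<subseteq> range (\<lambda>i. (q i, z i))" for i
    using that
  proof (induction w arbitrary: i)
    case (Cons c w)
    then have c: "c = z i" by (auto simp: word_patch_Cons inj)
    then have "w = map (\<lambda>j. z ((i + 1) + int j)) [0..<length w]"
      using Cons by (intro Cons.IH) (simp add: word_patch_Cons q)
    moreover have "map (\<lambda>j. z (i + int j)) [0..<Suc (length w)] =
        z i # map (\<lambda>j. z ((i + 1) + int j)) [0..<length w]"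
      by (simp add: upt_conv_Cons map_Suc_upt[symmetric] add_ac del: upt_Suc)
    ultimately show ?case using c by simp
  qed simp
  moreover have "w = [] \<or> (\<exists>i. x = q i)" using assms(3) by (cases w) (auto simp: word_patch_Cons)
  ultimately show ?thesis using assms(3) by auto
qed

lemma ex_tile_positions:
  fixes z :: "int \<Rightarrow> 'a"
  shows "\<exists>q :: int \<Rightarrow> real. q 0 = x \<and> (\<forall>i. q (i + 1) = q i + len (z i))"
proof -
  define q where "q i = x + (if 0 \<le> i then \<Sum>j<nat i. len (z (int j))
      else - (\<Sum>j<nat (- i). len (z (- 1 - int j))))" for i
  have "q (i + 1) = q i + len (z i)" for i
  proof (cases "0 \<le> i")
    case True
    then have "nat (i + 1) = Suc (nat i)" by simp
    then show ?thesis using True by (simp add: q_def)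
  next
    case False
    then have "nat (- i) = Suc (nat (- (i + 1)))" by simp
    moreover have "- 1 - int (nat (- (i + 1))) = i" using False by simp
    ultimately show ?thesis using False by (cases "i = - 1") (auto simp: q_def)
  qed
  then show ?thesis by (intro exI[of _ q]) (simp add: q_def)
qed

lemma tile_positions_cover:
  fixes q :: "int \<Rightarrow> real" and z :: "int \<Rightarrow> 'a"
  assumes q: "\<And>i. q (i + 1) = q i + len (z i)" and len: "\<And>c. \<mu> \<le> len c" "0 < \<mu>"
  shows "\<exists>i. q i \<le> y \<and> y \<le> q (i + 1)"
proof -
  have up: "q i + real n * \<mu> \<le> q (i + int n)" for i n
  proof (induction n)
    case (Suc n)
    then show ?case using q[of "i + int n"] len(1)[of "z (i + int n)"]
      by (simp add: add_ac distrib_right)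
  qed simp
  obtain n :: nat where "\<bar>y - q 0\<bar> / \<mu> < real n" using reals_Archimedean2 by blast
  then have n: "\<bar>y - q 0\<bar> < real n * \<mu>" using len by (simp add: divide_less_eq)
  define P where "P k \<longleftrightarrow> y < q (- int n + int k)" for k
  have "P (2 * n)" using up[of 0 n] n by (simp add: P_def)
  moreover have "\<not> P 0" using up[of "- int n" n] n by (simp add: P_def)
  ultimately obtain k where "\<not> P k" "P (Suc k)"
    by (metis LeastI not_less_Least lessI not0_implies_Suc)
  then show ?thesis by (intro exI[of _ "- int n + int k"]) (auto simp: P_def add_ac)
qed

context primitive_substitution
begin

text \<open>Prolong the word by one letter on each side at every stage. In stage \<open>n\<close> the letter with
  index \<open>i\<close> of the limit stands at position \<open>i + n\<close>.\<close>

lemma ex_biinfinite_extension: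
  assumes "legal \<theta> w"
  shows "\<exists>z :: int \<Rightarrow> 'a. (\<forall>i<length w. z (int i) = w ! i) \<and>
    (\<forall>i n. legal \<theta> (map (\<lambda>j. z (i + int j)) [0..<n]))"
proof -
  have "\<exists>v. legal \<theta> u \<longrightarrow> legal \<theta> v \<and> (\<exists>c d. v = c # u @ [d])" for u
    using legal_extend_left legal_extend_right by (metis append_Cons)
  then obtain E where E: "\<And>u. legal \<theta> u \<Longrightarrow> legal \<theta> (E u) \<and> (\<exists>c d. E u = c # u @ [d])"
    by metis
  define W where "W n = (E ^^ n) w" for n
  have leg: "legal \<theta> (W n)" for n by (induction n) (use assms E in \<open>auto simp: W_def\<close>)
  have W_Suc: "\<exists>c d. W (Suc n) = c # W n @ [d]" for n
    using E[OF leg[of n]] by (simp add: W_def)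
  have len_W: "length (W n) = length w + 2 * n" for n
  proof (induction n)
    case (Suc n)
    then show ?case using W_Suc[of n] by auto
  qed (simp add: W_def)
  have W_nth: "j < length (W n) \<Longrightarrow> W (n + d) ! (j + d) = W n ! j" for n d j
  proof (induction d)
    case (Suc d)
    obtain c e where "W (Suc (n + d)) = c # W (n + d) @ [e]" using W_Suc by blast
    then show ?case using Suc len_W[of "n + d"] len_W[of n] by (simp add: nth_append)
  qed simp
  \<comment> \<open>Stage \<open>\<bar>i\<bar> + 1\<close> is late enough to contain the letter with index \<open>i\<close>, even for empty \<open>w\<close>.\<close>
  define z where "z i = W (Suc (nat \<bar>i\<bar>)) ! nat (i + int (Suc (nat \<bar>i\<bar>)))" for i
  have z: "z i = W n ! nat (i + int n)" if "nat \<bar>i\<bar> < n" for i n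
  proof -
    define n0 where "n0 = Suc (nat \<bar>i\<bar>)"
    have "W (n0 + (n - n0)) ! (nat (i + int n0) + (n - n0)) = W n0 ! nat (i + int n0)"
      by (rule W_nth) (auto simp: len_W n0_def)
    moreover have "nat (i + int n0) + (n - n0) = nat (i + int n)" "n0 + (n - n0) = n"
      using that by (auto simp: n0_def)
    ultimately show ?thesis by (simp add: z_def n0_def)
  qed
  have "z (int i) = w ! i" if "i < length w" for i
  proof -
    have "z (int i) = W (0 + Suc i) ! (i + Suc i)" using z[of "int i" "Suc i"] by (simp only: nat_int_add) simp
    also have "\<dots> = W 0 ! i" by (rule W_nth) (use that in \<open>simp add: W_def\<close>)
    finally show ?thesis by (simp add: W_def)
  qed
  moreover have "legal \<theta> (map (\<lambda>j. z (i + int j)) [0..<n])" for i n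
  proof -
    define N where "N = Suc (nat \<bar>i\<bar> + n)"
    have "map (\<lambda>j. z (i + int j)) [0..<n] = take n (drop (nat (i + int N)) (W N))"
    proof (rule nth_equalityI)
      show "length (map (\<lambda>j. z (i + int j)) [0..<n]) = length (take n (drop (nat (i + int N)) (W N)))"
        by (simp add: len_W N_def)
      fix j assume "j < length (map (\<lambda>j. z (i + int j)) [0..<n])"
      then have j: "j < n" by simp
      have "z (i + int j) = W N ! nat (i + int j + int N)" using j by (intro z) (auto simp: N_def)
      also have "nat (i + int j + int N) = nat (i + int N) + j" by (auto simp: N_def)
      finally show "map (\<lambda>j. z (i + int j)) [0..<n] ! j = take n (drop (nat (i + int N)) (W N)) ! j"
        using j by (simp add: len_W N_def)
    qed
    moreover have "sublist (take n (drop (nat (i + int N)) (W N))) (W N)"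
      using sublist_order.order_trans[OF sublist_take sublist_drop] .
    ultimately show ?thesis using leg legal_sublist by metis
  qed
  ultimately show ?thesis by (intro exI[of _ z]) blast
qed

lemma ex_tiling_through:
  assumes "legal \<theta> w" and len: "\<And>c. 0 < len c"
  shows "\<exists>S\<in>tiling_space \<theta> len. word_patch len x w \<subseteq> S"
proof -
  obtain z :: "int \<Rightarrow> 'a" where z: "\<And>i. i < length w \<Longrightarrow> z (int i) = w ! i"
    "\<And>i n. legal \<theta> (map (\<lambda>j. z (i + int j)) [0..<n])"
    using ex_biinfinite_extension[OF assms(1)] by blast
  obtain q where q: "q 0 = x" "\<And>i. q (i + 1) = q i + len (z i)"
    using ex_tile_positions[of x len z] by blast
  define S where "S = range (\<lambda>i. (q i, z i))"
  have "map (\<lambda>j. z (0 + int j)) [0..<length w] = w" by (rule nth_equalityI) (auto simp: z(1))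
  then have sub: "word_patch len x w \<subseteq> S"
    using word_patch_window[of q len z 0 "length w"] q by (auto simp: S_def)
  have "\<exists>i. q i \<le> y \<and> y \<le> q (i + 1)" for y
  proof (rule tile_positions_cover[of q len z "min (len a) (len b)"])
    show "min (len a) (len b) \<le> len c" for c using letter_cases[of c] by auto
  qed (use len q in auto)
  then have "(\<Union>\<tau>\<in>S. tile_support len \<tau>) = UNIV"
    by (auto simp: S_def tile_support_def q(2))
  then have "tiling len S" using q(2) by (auto simp: tiling_def biinfinite_patch_def S_def)
  moreover have "legal \<theta> v" if "word_patch len y v \<subseteq> S" for y v
    using patch_in_tiling_is_window[of q len z y v] q(2) len that z(2) unfolding S_def by metis
  ultimately have "S \<in> tiling_space \<theta> len" by (auto simp: tiling_space_def)
  with sub show ?thesis by blast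
qed

end

section \<open>Neighbourhoods in the tiling space\<close>

lemma translate_in_tiling_space:
  assumes "S \<in> tiling_space \<theta> len"
  shows "translate t S \<in> tiling_space \<theta> len"
proof -
  have "tiling len S" and leg: "\<And>x w. word_patch len x w \<subseteq> S \<Longrightarrow> legal \<theta> w"
    using assms by (auto simp: tiling_space_def)
  then obtain q z where q: "\<forall>i. q (i + 1) = q i + len (z i)" and S: "S = range (\<lambda>i::int. (q i, z i))"
    and cover: "(\<Union>\<tau>\<in>S. tile_support len \<tau>) = UNIV"
    unfolding tiling_def biinfinite_patch_def by blast
  have tS: "translate t S = range (\<lambda>i. (q i - t, z i))"
    by (auto simp: S translate_def)
  have "y \<in> (\<Union>\<tau>\<in>translate t S. tile_support len \<tau>)" for y
  proof -
    have "y + t \<in> (\<Union>\<tau>\<in>S. tile_support len \<tau>)" using cover by simp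
    then obtain i where "q i \<le> y + t" "y + t \<le> q i + len (z i)"
      by (auto simp: S tile_support_def)
    then show ?thesis unfolding tS by (auto simp: tile_support_def algebra_simps)
  qed
  then have "tiling len (translate t S)"
    unfolding tiling_def biinfinite_patch_def tS using q
    by (intro conjI exI[of _ "\<lambda>i. q i - t"] exI[of _ z]) auto
  moreover have "legal \<theta> w" if "word_patch len x w \<subseteq> translate t S" for x w
  proof (rule leg)
    show "word_patch len (x - (- t)) w \<subseteq> S"
      using that translate_subset_iff[of "- t" "word_patch len x w" S] by (simp add: translate_word_patch)
  qed
  ultimately show ?thesis by (auto simp: tiling_space_def)
qed

lemma finite_subset_of_tiling_in_patch:
  assumes "S \<in> tiling_space \<theta> len" "finite P" "P \<subseteq> S"
  shows "\<exists>x w. legal \<theta> w \<and> P \<subseteq> word_patch len x w"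
proof -
  obtain q z where q: "\<forall>i. q (i + 1) = q i + len (z i)" and S: "S = range (\<lambda>i::int. (q i, z i))"
    using assms(1) unfolding tiling_space_def tiling_def biinfinite_patch_def by blast
  obtain I where I: "finite I" "P = (\<lambda>i. (q i, z i)) ` I"
    using assms(2,3) unfolding S by (meson finite_subset_image subset_UNIV)
  obtain l u where lu: "I \<subseteq> {l..<u}"
  proof -
    have "I \<subseteq> {Min I..<Max I + 1}" using I(1) by auto
    then show ?thesis by (rule that)
  qed
  then have "I \<subseteq> {l..<l + int (nat (u - l))}" by auto
  then have "P \<subseteq> word_patch len (q l) (map (\<lambda>j. z (l + int j)) [0..<nat (u - l)])"
    using I q by (subst word_patch_window) auto
  moreover have "word_patch len (q l) (map (\<lambda>j. z (l + int j)) [0..<nat (u - l)]) \<subseteq> S"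
    using q by (subst word_patch_window) (auto simp: S)
  ultimately show ?thesis using assms(1) unfolding tiling_space_def by blast
qed

text \<open>Neighbourhoods given by finite subsets of \<open>S\<close>, rather than by patches, are closed under finite
  intersection by taking unions of the subsets and the smaller tolerance.\<close>

lemma tiling_topology_neighbourhood:
  assumes "openin (tiling_topology \<theta> len) V" "S \<in> V"
  shows "\<exists>P e. finite P \<and> P \<subseteq> S \<and> 0 < e \<and> S \<in> tiling_space \<theta> len \<and>
    (\<forall>S'\<in>tiling_space \<theta> len. \<forall>y. \<bar>y\<bar> < e \<longrightarrow> P \<subseteq> translate y S' \<longrightarrow> S' \<in> V)"
proof -
  have "generate_topology_on {cylinder \<theta> len (word_patch len x w) U | x w U. open U} V"
    using assms(1) by (simp add: tiling_topology_def openin_topology_generated_by_iff)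
  then show ?thesis using assms(2)
  proof (induction arbitrary: S rule: generate_topology_on.induct)
    case (Int A B)
    obtain P e where P: "finite P" "P \<subseteq> S" "0 < e" "S \<in> tiling_space \<theta> len"
      "\<And>S' y. S' \<in> tiling_space \<theta> len \<Longrightarrow> \<bar>y\<bar> < e \<Longrightarrow> P \<subseteq> translate y S' \<Longrightarrow> S' \<in> A"
      using Int.IH(1)[of S] Int.prems by blast
    obtain Q d where Q: "finite Q" "Q \<subseteq> S" "0 < d"
      "\<And>S' y. S' \<in> tiling_space \<theta> len \<Longrightarrow> \<bar>y\<bar> < d \<Longrightarrow> Q \<subseteq> translate y S' \<Longrightarrow> S' \<in> B"
      using Int.IH(2)[of S] Int.prems by blast
    show ?case
      using P Q by (intro exI[of _ "P \<union> Q"] exI[of _ "min e d"]) auto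
  next
    case (UN K)
    then obtain k where k: "k \<in> K" "S \<in> k" by blast
    then obtain P e where P: "finite P" "P \<subseteq> S" "0 < e" "S \<in> tiling_space \<theta> len"
      "\<And>S' y. S' \<in> tiling_space \<theta> len \<Longrightarrow> \<bar>y\<bar> < e \<Longrightarrow> P \<subseteq> translate y S' \<Longrightarrow> S' \<in> k"
      using UN.IH[of k S] by blast
    then show ?case using k by (intro exI[of _ P] exI[of _ e]) blast
  next
    case (Basis s)
    then obtain x w U where s: "s = cylinder \<theta> len (word_patch len x w) U" "open U" by blast
    then obtain y0 where y0: "S \<in> tiling_space \<theta> len" "y0 \<in> U" "word_patch len x w \<subseteq> translate y0 S"
      using Basis.prems by (auto simp: cylinder_def)
    obtain e where e: "0 < e" "\<And>y. dist y y0 < e \<Longrightarrow> y \<in> U" using s(2) y0(2) open_dist by blast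
    show ?case
    proof (intro exI[of _ "translate (- y0) (word_patch len x w)"] exI[of _ e] conjI ballI allI impI)
      show "finite (translate (- y0) (word_patch len x w))"
        by (simp add: translate_def word_patch_def)
      show "translate (- y0) (word_patch len x w) \<subseteq> S" using y0(3) by (simp add: translate_subset_iff)
      fix S' y assume S': "S' \<in> tiling_space \<theta> len" "\<bar>y\<bar> < e"
        "translate (- y0) (word_patch len x w) \<subseteq> translate y S'"
      then have "word_patch len x w \<subseteq> translate (y0 + y) S'"
        by (simp add: translate_subset_iff translate_translate)
      moreover have "y0 + y \<in> U" using S'(2) e(2) by (auto simp: dist_real_def)
      ultimately show "S' \<in> s" using S'(1) by (auto simp: s cylinder_def)
    qed (use e y0 in auto)
  qed auto
qed

context primitive_substitution
begin

text \<open>The first word is placed exactly where the first open set prescribes it; the error in the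
  distance is absorbed by the small translation that the second open set tolerates.\<close>

lemma topologically_mixing_if_words_at_distance:
  assumes len: "\<And>c. 0 < len c"
    and dist: "\<And>u v e. legal \<theta> u \<Longrightarrow> legal \<theta> v \<Longrightarrow> 0 < e \<Longrightarrow>
      \<exists>R. \<forall>t>R. \<exists>s. legal \<theta> (u @ s @ v) \<and> \<bar>weight len (u @ s) - t\<bar> < e"
  shows "topologically_mixing (tiling_topology \<theta> len) translate"
  unfolding topologically_mixing_def
proof (intro allI impI)
  fix V W
  assume VW: "openin (tiling_topology \<theta> len) V \<and> V \<noteq> {} \<and> openin (tiling_topology \<theta> len) W \<and> W \<noteq> {}"
  then obtain S1 S2 where "S1 \<in> V" "S2 \<in> W" by blast
  obtain P1 e1 where P1: "finite P1" "P1 \<subseteq> S1" "0 < e1" "S1 \<in> tiling_space \<theta> len"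
    "\<And>S' y. S' \<in> tiling_space \<theta> len \<Longrightarrow> \<bar>y\<bar> < e1 \<Longrightarrow> P1 \<subseteq> translate y S' \<Longrightarrow> S' \<in> V"
    using tiling_topology_neighbourhood[of \<theta> len V S1] VW \<open>S1 \<in> V\<close> by blast
  obtain P2 e2 where P2: "finite P2" "P2 \<subseteq> S2" "0 < e2" "S2 \<in> tiling_space \<theta> len"
    "\<And>S' y. S' \<in> tiling_space \<theta> len \<Longrightarrow> \<bar>y\<bar> < e2 \<Longrightarrow> P2 \<subseteq> translate y S' \<Longrightarrow> S' \<in> W"
    using tiling_topology_neighbourhood[of \<theta> len W S2] VW \<open>S2 \<in> W\<close> by blast
  obtain x1 u where u: "legal \<theta> u" "P1 \<subseteq> word_patch len x1 u"
    using finite_subset_of_tiling_in_patch P1 by metis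
  obtain x2 v where v: "legal \<theta> v" "P2 \<subseteq> word_patch len x2 v"
    using finite_subset_of_tiling_in_patch P2 by metis
  obtain R where R: "\<And>t. t > R \<Longrightarrow> \<exists>s. legal \<theta> (u @ s @ v) \<and> \<bar>weight len (u @ s) - t\<bar> < e2"
    using dist[OF u(1) v(1) P2(3)] by blast
  have "translate t ` V \<inter> W \<noteq> {}" if t: "t > R - x2 + x1" for t
  proof -
    obtain s where s: "legal \<theta> (u @ s @ v)" "\<bar>weight len (u @ s) - (t + x2 - x1)\<bar> < e2"
      using R[of "t + x2 - x1"] t by auto
    obtain S where S: "S \<in> tiling_space \<theta> len" "word_patch len x1 ((u @ s) @ v) \<subseteq> S"
      using ex_tiling_through[of "u @ s @ v" len x1] s(1) len by auto
    define y where "y = weight len (u @ s) - (t + x2 - x1)"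
    have "word_patch len x1 u \<subseteq> S" using S(2) by (simp add: word_patch_append)
    then have "S \<in> V" using P1(5)[OF S(1), of 0] P1(3) u(2) by auto
    moreover have "translate t S \<in> W"
    proof (rule P2(5))
      show "translate t S \<in> tiling_space \<theta> len" using S(1) by (rule translate_in_tiling_space)
      show "\<bar>y\<bar> < e2" using s(2) by (simp add: y_def)
      have "word_patch len (x1 + weight len (u @ s)) v \<subseteq> S"
        using S(2) unfolding word_patch_append by blast
      then have "translate (y + t) (word_patch len (x1 + weight len (u @ s)) v) \<subseteq> translate (y + t) S"
        by (rule translate_mono)
      moreover have "x1 + weight len (u @ s) - (y + t) = x2" by (simp add: y_def)
      ultimately have "word_patch len x2 v \<subseteq> translate (y + t) S" by (simp only: translate_word_patch)
      then show "P2 \<subseteq> translate y (translate t S)" using v(2) by (simp add: translate_translate)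
    qed
    ultimately show ?thesis by blast
  qed
  then show "\<exists>R. \<forall>t>R. translate t ` V \<inter> W \<noteq> {}" by blast
qed

end

section \<open>Topological mixing\<close>

theorem theorem46:
  fixes \<theta> :: "'a \<Rightarrow> 'a list set"
    and a b :: 'a
    and len :: "'a \<Rightarrow> real"
    and lambda2 :: complex
  assumes "a \<noteq> b" and "(UNIV :: 'a set) = {a, b}"
    and "random_substitution \<theta>"
    and "compatible \<theta>"
    and "primitive_mat (subst_matrix [a, b] \<theta>)"
    and "second_eigenvalue (subst_matrix [a, b] \<theta>) lambda2"
    and "cmod lambda2 > 1"
    and "len a > 0" and "len b > 0"
    and "len a / len b \<notin> \<rat>"
  shows "topologically_mixing (tiling_topology \<theta> len) translate"
proof -
  interpret T: two_letter_substitution \<theta> a b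
    using assms by unfold_locales auto
  have second: "second_eigenvalue T.M lambda2" using assms(6) by (simp add: T.M_def)
  obtain p g f l1 l2 where "expanding_substitution \<theta> a b p g f l1 l2"
    using T.ex_expanding(1)[OF second assms(7)] by blast
  then interpret E: expanding_substitution \<theta> a b p g f l1 l2 .
  note det = T.ex_expanding(2)[OF second assms(7), unfolded T.A_def T.B_def T.C_def T.D_def]
  show ?thesis
  proof (rule E.topologically_mixing_if_words_at_distance)
    show "0 < len c" for c using E.letter_cases[of c] assms(8,9) by auto
    show "\<exists>R. \<forall>t>R. \<exists>s. legal \<theta> (u @ s @ v) \<and> \<bar>weight len (u @ s) - t\<bar> < e"
      if "legal \<theta> u" "legal \<theta> v" "0 < e" for u v e
      using E.legal_words_at_distance[OF E.discrepancy_unbounded det assms(8,9,10) that] .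
  qed
qed

end
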